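(* Let $P = \{ p_{1}, \ldots, p_{d} \}$ and $Q = \{ q_{1}, \ldots, q_{d} \}$ be finite partially ordered sets with $|P| = |Q| = d$, and let $K$ be a field. Let $I_{\Omega(P,-Q)} \subset K[\mathbf{x},\mathbf{y},z]$ be the toric ideal of $\Omega(P,-Q)$. Let $<$ be a reverse lexicographic order on $K[\mathbf{x},\mathbf{y},z]$ satisfying - $z < x_I$ and $z < y_J$ for all $\emptyset \ne I \in \mathcal{J}(P)$ and $\emptyset \neq J \in \mathcal{J}(Q)$; - $x_{I'} < x_I$ if $I' \subsetneq I$; - $y_{J'} < y_J$ if $J' \subsetneq J$. Let $\mathcal{G}$ be the set of the following binomials, where $x_\emptyset = y_\emptyset = z$: (i) $x_I x_{I'} - x_{I \cap I'} x_{I \cup I'}$, for $I, I' \in \mathcal{J}(P)$; (ii) $y_J y_{J'} - y_{J \cap J'} y_{J \cup J'}$, for $J, J' \in \mathcal{J}(Q)$; (iii) $x_I y_J - x_{I \setminus \{p_i\}} y_{J \setminus \{q_i\}}$, for $I \in \mathcal{J}(P)$, $J \in \mathcal{J}(Q)$ and $1 \le i \le d$ such that $p_i$ is a maximal element of $I$ and $q_i$ is a maximal element of $J$. Suppose that $P$ and $Q$ possess a common linear extension. Then $\mathcal{G}$ is a Gröbner basis of $I_{\Omega(P,-Q)}$ with respect to $<$.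
   Context: A subset $I$ of a finite poset $P$ is a poset ideal of $P$ if $p_i \in I$ and $p_j \in P$ with $p_j \le p_i$ imply $p_j \in I$; in particular $\emptyset$ and $P$ are poset ideals. Let $\mathcal{J}(P)$ and $\mathcal{J}(Q)$ denote the sets of poset ideals of $P$ and $Q$. A linear extension of $P = \{p_1,\ldots,p_d\}$ is a permutation $\sigma = i_1 i_2 \cdots i_d$ of $[d]=\{1,\ldots,d\}$ such that $a < b$ whenever $p_{i_a} < p_{i_b}$ in $P$; likewise for $Q = \{q_1,\ldots,q_d\}$ (with $q$ in place of $p$). $P$ and $Q$ possess a common linear extension if some permutation of $[d]$ is a linear extension of both. The labelings of $P$ and $Q$ by $1,\ldots,d$ are fixed. Let $\mathbf{e}_1,\ldots,\mathbf{e}_d$ be the canonical unit coordinate vectors of $\mathbb{R}^d$. For $I \subset P$ put $\rho(I) = \sum_{p_i \in I} \mathbf{e}_i$, and for $J \subset Q$ put $\rho(J) = \sum_{q_j \in J} \mathbf{e}_j$. Define $$\Omega(P,-Q) = \{ \rho(I) : \emptyset \ne I \in \mathcal{J}(P) \} \cup \{ -\rho(J) : \emptyset \neq J \in \mathcal{J}(Q) \} \cup \{ \mathbf{0} \} \subset \mathbb{Z}^d.$$ Let $K[\mathbf{t},\mathbf{t}^{-1},s] = K[t_1,\ldots,t_d,t_1^{-1},\ldots,t_d^{-1},s]$, and for $\alpha = (\alpha_1,\ldots,\alpha_d) \in \mathbb{Z}^d$ write $\mathbf{t}^\alpha s = t_1^{\alpha_1}\cdots t_d^{\alpha_d}s$.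 The toric ring $K[\Omega(P,-Q)]$ is the subring of $K[\mathbf{t},\mathbf{t}^{-1},s]$ generated over $K$ by the Laurent monomials $\mathbf{t}^\alpha s$ with $\alpha \in \Omega(P,-Q)$. Let $$K[\mathbf{x},\mathbf{y},z] = K[\{x_I\}_{\emptyset \ne I \in \mathcal{J}(P)} \cup \{y_J\}_{\emptyset \neq J \in \mathcal{J}(Q)} \cup \{z\}]$$ be the polynomial ring in $|\Omega(P,-Q)|$ variables over $K$, and let $\pi : K[\mathbf{x},\mathbf{y},z] \to K[\Omega(P,-Q)]$ be the surjective $K$-algebra homomorphism with $\pi(x_I) = \mathbf{t}^{\rho(I)}s$, $\pi(y_J) = \mathbf{t}^{-\rho(J)}s$, $\pi(z) = s$. The toric ideal $I_{\Omega(P,-Q)}$ is the kernel of $\pi$. The reverse lexicographic order induced by a total order on the variables is the (graded) monomial order in which $u < v$ if $\deg u < \deg v$, or $\deg u = \deg v$ and, for the smallest variable whose exponents in $u$ and $v$ differ, its exponent in $u$ is larger than that in $v$. Binomials in the list defining $\mathcal{G}$ that are identically zero (for example those in (i) with $I \subset I'$) are disregarded. *)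

theory Defs
  imports
    "HOL-Algebra.RingHom"
    "HOL-Algebra.Generated_Rings"
    "HOL-Combinatorics.Permutations"
    "HOL-Library.Poly_Mapping"
    "HOL-Library.Product_Plus"
begin

text \<open>
  A finite poset \<open>P = {p\<^sub>1, \<dots>, p\<^sub>d}\<close> is given by a carrier \<open>P\<close>, its reflexive order relation
  \<open>r\<close> (where \<open>(x, y) \<in> r\<close> means \<open>x \<le> y\<close>) and a labelling \<open>p\<close>, a bijection from \<open>{1..d}\<close> to \<open>P\<close>.
\<close>

definition labelled_poset :: "nat \<Rightarrow> 'a set \<Rightarrow> 'a rel \<Rightarrow> (nat \<Rightarrow> 'a) \<Rightarrow> bool" where
  "labelled_poset d P r p \<longleftrightarrow> partial_order_on P r \<and> bij_betw p {1..d} P"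

definition poset_ideals :: "'a set \<Rightarrow> 'a rel \<Rightarrow> 'a set set" where
  "poset_ideals P r = {I. I \<subseteq> P \<and> (\<forall>x\<in>I. \<forall>y\<in>P. (y, x) \<in> r \<longrightarrow> y \<in> I)}"

definition maximal_in :: "'a rel \<Rightarrow> 'a set \<Rightarrow> 'a \<Rightarrow> bool" where
  "maximal_in r I x \<longleftrightarrow> x \<in> I \<and> (\<forall>y\<in>I. (x, y) \<in> r \<longrightarrow> y = x)"

definition linear_extension :: "nat \<Rightarrow> 'a rel \<Rightarrow> (nat \<Rightarrow> 'a) \<Rightarrow> (nat \<Rightarrow> nat) \<Rightarrow> bool" where
  "linear_extension d r p \<sigma> \<longleftrightarrow> \<sigma> permutes {1..d} \<and>
     (\<forall>a\<in>{1..d}. \<forall>b\<in>{1..d}. (p (\<sigma> a), p (\<sigma> b)) \<in> r \<and> p (\<sigma> a) \<noteq> p (\<sigma> b) \<longrightarrow> a < b)"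

definition have_common_linear_extension ::
  "nat \<Rightarrow> 'a rel \<Rightarrow> (nat \<Rightarrow> 'a) \<Rightarrow> 'b rel \<Rightarrow> (nat \<Rightarrow> 'b) \<Rightarrow> bool" where
  "have_common_linear_extension d rP p rQ q \<longleftrightarrow>
     (\<exists>\<sigma>. linear_extension d rP p \<sigma> \<and> linear_extension d rQ q \<sigma>)"

text \<open>
  Vectors of the lattice of rank \<open>d\<close> are the maps of type \<open>nat \<Rightarrow>\<^sub>0 int\<close> supported in \<open>{1..d}\<close>;
  the unit vector \<open>e\<^sub>i\<close> is \<open>Poly_Mapping.single i 1\<close>.
\<close>

definition rho :: "nat \<Rightarrow> (nat \<Rightarrow> 'a) \<Rightarrow> 'a set \<Rightarrow> (nat \<Rightarrow>\<^sub>0 int)" where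
  "rho d p I = (\<Sum>i | i \<in> {1..d} \<and> p i \<in> I. Poly_Mapping.single i 1)"

definition Omega ::
  "nat \<Rightarrow> 'a set \<Rightarrow> 'a rel \<Rightarrow> (nat \<Rightarrow> 'a) \<Rightarrow> 'b set \<Rightarrow> 'b rel \<Rightarrow> (nat \<Rightarrow> 'b) \<Rightarrow> (nat \<Rightarrow>\<^sub>0 int) set" where
  "Omega d P rP p Q rQ q =
     {rho d p I | I. I \<in> poset_ideals P rP \<and> I \<noteq> {}} \<union>
     {- rho d q J | J. J \<in> poset_ideals Q rQ \<and> J \<noteq> {}} \<union> {0}"

text \<open>
  Polynomials with variables of type \<open>'v\<close> are finitely supported maps from exponent vectors
  \<open>'v \<Rightarrow>\<^sub>0 nat\<close> to coefficients, multiplied by convolution. Only the variables in the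
  set \<open>V\<close> may occur in the elements of \<open>mpoly_ring V\<close>.
\<close>

type_synonym ('v, 'k) mpoly = "('v \<Rightarrow>\<^sub>0 nat) \<Rightarrow>\<^sub>0 'k"

definition mpoly_ring :: "'v set \<Rightarrow> ('v, 'k::field) mpoly ring" where
  "mpoly_ring V =
     \<lparr>carrier = {f. \<forall>m\<in>Poly_Mapping.keys f. Poly_Mapping.keys m \<subseteq> V},
      monoid.mult = (*), monoid.one = 1, ring.zero = 0, ring.add = (+)\<rparr>"

text \<open>
  The exponent \<open>(\<alpha>, n)\<close> of type \<open>(nat \<Rightarrow>\<^sub>0 int) \<times> nat\<close> stands for the Laurent monomial
  \<open>t\<^sup>\<alpha> s\<^sup>n\<close>.
\<close>

type_synonym 'k laurent = "((nat \<Rightarrow>\<^sub>0 int) \<times> nat) \<Rightarrow>\<^sub>0 'k"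

definition laurent_ring :: "nat \<Rightarrow> ('k::field) laurent ring" where
  "laurent_ring d =
     \<lparr>carrier = {f. \<forall>(\<alpha>, n)\<in>Poly_Mapping.keys f. Poly_Mapping.keys \<alpha> \<subseteq> {1..d}},
      monoid.mult = (*), monoid.one = 1, ring.zero = 0, ring.add = (+)\<rparr>"

definition t_s :: "(nat \<Rightarrow>\<^sub>0 int) \<Rightarrow> ('k::field) laurent" where
  "t_s \<alpha> = Poly_Mapping.single (\<alpha>, 1) 1"

text \<open>Generation over \<open>K\<close>: the constants \<open>Poly_Mapping.single 0 c\<close> are added to the generators.\<close>

definition toric_ring :: "nat \<Rightarrow> (nat \<Rightarrow>\<^sub>0 int) set \<Rightarrow> ('k::field) laurent ring" where
  "toric_ring d A = (laurent_ring d)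
     \<lparr>carrier := generate_ring (laurent_ring d) (Set.range (Poly_Mapping.single 0) \<union> t_s ` A)\<rparr>"

datatype ('a, 'b) toric_var = Xvar "'a set" | Yvar "'b set" | Zvar

definition toric_vars :: "'a set \<Rightarrow> 'a rel \<Rightarrow> 'b set \<Rightarrow> 'b rel \<Rightarrow> ('a, 'b) toric_var set" where
  "toric_vars P rP Q rQ =
     Xvar ` (poset_ideals P rP - {{}}) \<union> Yvar ` (poset_ideals Q rQ - {{}}) \<union> {Zvar}"

text \<open>The \<open>K\<close>-algebra homomorphism that substitutes \<open>\<phi> v\<close> for each variable \<open>v\<close>.\<close>

definition subst_hom ::
  "('v \<Rightarrow> ('k::field) laurent) \<Rightarrow> ('v, 'k) mpoly \<Rightarrow> 'k laurent" where
  "subst_hom \<phi> f = (\<Sum>m\<in>Poly_Mapping.keys f.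
     Poly_Mapping.single 0 (Poly_Mapping.lookup f m) *
     (\<Prod>v\<in>Poly_Mapping.keys m. \<phi> v ^ Poly_Mapping.lookup m v))"

fun pi_var :: "nat \<Rightarrow> (nat \<Rightarrow> 'a) \<Rightarrow> (nat \<Rightarrow> 'b) \<Rightarrow> ('a, 'b) toric_var \<Rightarrow> ('k::field) laurent" where
  "pi_var d p q (Xvar I) = t_s (rho d p I)"
| "pi_var d p q (Yvar J) = t_s (- rho d q J)"
| "pi_var d p q Zvar = t_s 0"

definition toric_ideal ::
  "nat \<Rightarrow> 'a set \<Rightarrow> 'a rel \<Rightarrow> (nat \<Rightarrow> 'a) \<Rightarrow> 'b set \<Rightarrow> 'b rel \<Rightarrow> (nat \<Rightarrow> 'b) \<Rightarrow>
   (('a, 'b) toric_var, 'k::field) mpoly set" where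
  "toric_ideal d P rP p Q rQ q =
     a_kernel (mpoly_ring (toric_vars P rP Q rQ)) (toric_ring d (Omega d P rP p Q rQ q))
       (subst_hom (pi_var d p q))"

definition mdeg :: "('v \<Rightarrow>\<^sub>0 nat) \<Rightarrow> nat" where
  "mdeg m = (\<Sum>v\<in>Poly_Mapping.keys m. Poly_Mapping.lookup m v)"

text \<open>
  Strict graded reverse lexicographic order; \<open>r\<close> is the reflexive total order on the variables,
  and \<open>w\<close> below is the smallest variable whose exponents in \<open>u\<close> and \<open>v\<close> differ. Only
  monomials in the variables from the field of \<open>r\<close> are to be compared.
\<close>

definition revlex :: "'v rel \<Rightarrow> ('v \<Rightarrow>\<^sub>0 nat) \<Rightarrow> ('v \<Rightarrow>\<^sub>0 nat) \<Rightarrow> bool" where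
  "revlex r u v \<longleftrightarrow> mdeg u < mdeg v \<or>
     mdeg u = mdeg v \<and>
     (\<exists>w. Poly_Mapping.lookup u w > Poly_Mapping.lookup v w \<and>
        (\<forall>w'. (w', w) \<in> r \<and> w' \<noteq> w \<longrightarrow> Poly_Mapping.lookup u w' = Poly_Mapping.lookup v w'))"

definition initial_monomial ::
  "(('v \<Rightarrow>\<^sub>0 nat) \<Rightarrow> ('v \<Rightarrow>\<^sub>0 nat) \<Rightarrow> bool) \<Rightarrow> ('v, 'k::field) mpoly \<Rightarrow> ('v, 'k) mpoly" where
  "initial_monomial prec f = Poly_Mapping.single
     (THE m. m \<in> Poly_Mapping.keys f \<and> (\<forall>m'\<in>Poly_Mapping.keys f. m' \<noteq> m \<longrightarrow> prec m' m)) 1"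

definition groebner_basis ::
  "'v set \<Rightarrow> (('v \<Rightarrow>\<^sub>0 nat) \<Rightarrow> ('v \<Rightarrow>\<^sub>0 nat) \<Rightarrow> bool) \<Rightarrow>
   ('v, 'k::field) mpoly set \<Rightarrow> ('v, 'k) mpoly set \<Rightarrow> bool" where
  "groebner_basis V prec I G \<longleftrightarrow>
     finite G \<and> G \<subseteq> I - {0} \<and>
     Idl\<^bsub>mpoly_ring V\<^esub> (initial_monomial prec ` (I - {0})) =
     Idl\<^bsub>mpoly_ring V\<^esub> (initial_monomial prec ` G)"

definition Var :: "'v \<Rightarrow> ('v, 'k::field) mpoly" where
  "Var v = Poly_Mapping.single (Poly_Mapping.single v 1) 1"

definition x_var :: "'a set \<Rightarrow> (('a, 'b) toric_var, 'k::field) mpoly" where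
  "x_var I = Var (if I = {} then Zvar else Xvar I)"

definition y_var :: "'b set \<Rightarrow> (('a, 'b) toric_var, 'k::field) mpoly" where
  "y_var J = Var (if J = {} then Zvar else Yvar J)"

definition toric_binomials ::
  "nat \<Rightarrow> 'a set \<Rightarrow> 'a rel \<Rightarrow> (nat \<Rightarrow> 'a) \<Rightarrow> 'b set \<Rightarrow> 'b rel \<Rightarrow> (nat \<Rightarrow> 'b) \<Rightarrow>
   (('a, 'b) toric_var, 'k::field) mpoly set" where
  "toric_binomials d P rP p Q rQ q =
     ({x_var I * x_var I' - x_var (I \<inter> I') * x_var (I \<union> I') | I I'.
         I \<in> poset_ideals P rP \<and> I' \<in> poset_ideals P rP} \<union>
      {y_var J * y_var J' - y_var (J \<inter> J') * y_var (J \<union> J') | J J'.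
         J \<in> poset_ideals Q rQ \<and> J' \<in> poset_ideals Q rQ} \<union>
      {x_var I * y_var J - x_var (I - {p i}) * y_var (J - {q i}) | I J i.
         I \<in> poset_ideals P rP \<and> J \<in> poset_ideals Q rQ \<and> i \<in> {1..d} \<and>
         maximal_in rP I (p i) \<and> maximal_in rQ J (q i)}) - {0}"

end

theory Submission
  imports Defs
begin

text \<open>
  Call a monomial standard if no initial monomial of a listed binomial divides it. Every listed
  binomial \<open>u - v\<close> is homogeneous, lies in the kernel of \<open>\<pi>\<close>, and has \<open>u\<close> as its initial monomial.
  Hence the smallest monomial in a fibre of \<open>\<pi>\<close> is standard: replacing a factor \<open>u\<close> by \<open>v\<close> would
  give a smaller monomial of the same fibre. If \<open>\<pi>\<close> is injective on standard monomials, each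
  fibre contains exactly one. Suppose then that the initial monomial \<open>m\<close> of some \<open>f \<noteq> 0\<close> in the
  toric ideal were standard. Since \<open>\<pi> f = 0\<close>, another monomial of \<open>f\<close>, smaller than \<open>m\<close>, lies in
  the fibre of \<open>m\<close>, so the smallest element of that fibre is a second standard monomial, a
  contradiction. So \<open>m\<close> is divisible by an initial monomial of the list, and the
  two initial ideals agree. This is \<open>groebner_basis_criterion\<close>.

  Injectivity on standard monomials is where the posets enter. By the quadrics in the \<open>x\<^sub>I\<close> alone
  and in the \<open>y\<^sub>J\<close> alone, the ideals \<open>I\<close> with \<open>x\<^sub>I\<close> in a standard monomial form a chain, and so do
  the ideals \<open>J\<close>. Let \<open>\<alpha>\<^sub>i\<close> be the number of \<open>I\<close>, with multiplicity, that contain \<open>p\<^sub>i\<close>, and \<open>\<beta>\<^sub>i\<close>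
  the number of \<open>J\<close> that contain \<open>q\<^sub>i\<close>. A multiset of nonempty sets that form a chain is determined
  by how often it covers each point (\<open>chain_supported_unique\<close>), so \<open>\<alpha>\<close> and \<open>\<beta>\<close> determine the
  variables other than \<open>z\<close>, and the degree then determines the exponent of \<open>z\<close>. The image under \<open>\<pi>\<close>
  records only the degree and \<open>\<alpha> - \<beta>\<close>.

  Suppose two standard monomials, with counts \<open>\<alpha>, \<beta>\<close> and \<open>\<alpha>', \<beta>'\<close>, have the same image but
  \<open>\<alpha> \<noteq> \<alpha>'\<close>, and let \<open>i\<close> be the last label in
  the common linear extension with \<open>\<alpha>\<^sub>i \<noteq> \<alpha>'\<^sub>i\<close>, say \<open>\<alpha>\<^sub>i > \<alpha>'\<^sub>i\<close>; then \<open>\<beta>\<^sub>i > \<beta>'\<^sub>i\<close> too. If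
  \<open>p\<^sub>j > p\<^sub>i\<close>, then \<open>j\<close> comes later, so \<open>\<alpha>\<^sub>j = \<alpha>'\<^sub>j \<le> \<alpha>'\<^sub>i < \<alpha>\<^sub>i\<close>. Therefore the smallest \<open>I\<close> of the
  chain that contains \<open>p\<^sub>i\<close> contains no \<open>p\<^sub>j > p\<^sub>i\<close>, that is, \<open>p\<^sub>i\<close> is maximal in it
  (\<open>maximal_in_chain_member\<close>). In the same way \<open>q\<^sub>i\<close> is maximal in some \<open>J\<close> of the other chain, and
  \<open>x\<^sub>I y\<^sub>J\<close> is the initial monomial of a binomial of the third kind: a contradiction
  (\<open>standard_count_not_greater\<close>).
\<close>

section \<open>The reverse lexicographic order on monomials\<close>

lemma finite_linear_order_least:
  assumes "linear_order_on V r" "finite D" "D \<subseteq> V" "D \<noteq> {}"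
  shows "\<exists>w\<in>D. \<forall>w'\<in>D. (w, w') \<in> r"
proof -
  have "transp_on D (\<lambda>x y. (x, y) \<in> r)" "totalp_on D (\<lambda>x y. (x, y) \<in> r)"
    using assms unfolding order_on_defs trans_def total_on_def transp_on_def totalp_on_def by blast+
  then obtain w where "w \<in> D" "\<forall>w'\<in>D. w' \<noteq> w \<longrightarrow> (w, w') \<in> r"
    using Finite_Set.bex_least_element[OF assms(2), of "\<lambda>x y. (x, y) \<in> r"] assms(4) by blast
  moreover have "(w, w) \<in> r"
    using assms \<open>w \<in> D\<close> unfolding order_on_defs refl_on_def by blast
  ultimately show ?thesis by metis
qed

lemma revlex_irrefl: "\<not> revlex r u u"
  by (simp add: revlex_def)

text \<open>
  If \<open>v\<close> decides between \<open>a\<close> and \<open>b\<close>, and \<open>w\<close> between \<open>b\<close> and \<open>c\<close>, then the smaller of \<open>v\<close> and \<open>w\<close>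
  decides between \<open>a\<close> and \<open>c\<close>. The deciding variable has a positive exponent in \<open>a\<close> or \<open>b\<close>, hence
  lies in \<open>V\<close>, where the variables are comparable.
\<close>

lemma revlex_trans:
  assumes lin: "linear_order_on V r"
    and V: "Poly_Mapping.keys a \<subseteq> V" "Poly_Mapping.keys b \<subseteq> V"
    and ab: "revlex r a b" and bc: "revlex r b c"
  shows "revlex r a c"
proof (cases "mdeg a = mdeg b \<and> mdeg b = mdeg c")
  case True
  obtain v where v: "Poly_Mapping.lookup a v > Poly_Mapping.lookup b v"
      "\<And>w'. (w', v) \<in> r \<Longrightarrow> w' \<noteq> v \<Longrightarrow> Poly_Mapping.lookup a w' = Poly_Mapping.lookup b w'"
    using ab True unfolding revlex_def by auto
  obtain w where w: "Poly_Mapping.lookup b w > Poly_Mapping.lookup c w"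
      "\<And>w'. (w', w) \<in> r \<Longrightarrow> w' \<noteq> w \<Longrightarrow> Poly_Mapping.lookup b w' = Poly_Mapping.lookup c w'"
    using bc True unfolding revlex_def by auto
  have "v \<in> V" "w \<in> V"
    using v(1) w(1) V by (auto simp: in_keys_iff subset_iff)
  then have tot: "v = w \<or> (v, w) \<in> r \<or> (w, v) \<in> r" and tr: "trans r" and an: "antisym r"
    using lin unfolding order_on_defs total_on_def by blast+
  define z where "z = (if (v, w) \<in> r then v else w)"
  have less: "(w', v) \<in> r \<and> w' \<noteq> v \<and> (w', w) \<in> r \<and> w' \<noteq> w" if "(w', z) \<in> r" "w' \<noteq> z" for w'
    using that tot tr an unfolding z_def trans_def antisym_def by (metis (full_types))
  have "Poly_Mapping.lookup a z > Poly_Mapping.lookup c z"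
  proof (cases "v = w")
    case False
    then show ?thesis
      using v w tot an unfolding z_def antisym_def by (metis (full_types))
  qed (use v w z_def in auto)
  moreover have "Poly_Mapping.lookup a w' = Poly_Mapping.lookup c w'" if "(w', z) \<in> r" "w' \<noteq> z" for w'
    using less[OF that] v(2) w(2) by simp
  ultimately show ?thesis
    using True unfolding revlex_def by auto
next
  case False
  then show ?thesis
    using ab bc unfolding revlex_def by auto
qed

lemma revlex_total:
  assumes lin: "linear_order_on V r"
    and V: "Poly_Mapping.keys a \<subseteq> V" "Poly_Mapping.keys b \<subseteq> V" and "a \<noteq> b"
  shows "revlex r a b \<or> revlex r b a"
proof -
  define D where "D = {w. Poly_Mapping.lookup a w \<noteq> Poly_Mapping.lookup b w}"
  have "D \<subseteq> Poly_Mapping.keys a \<union> Poly_Mapping.keys b"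
    unfolding D_def by (auto simp: in_keys_iff)
  then have "finite D" "D \<subseteq> V"
    using V by (auto intro: finite_subset)
  moreover have "D \<noteq> {}"
    using \<open>a \<noteq> b\<close> unfolding D_def by (auto intro: poly_mapping_eqI)
  ultimately obtain w where w: "w \<in> D" "\<forall>w'\<in>D. (w, w') \<in> r"
    using finite_linear_order_least[OF lin] by blast
  have "Poly_Mapping.lookup a w' = Poly_Mapping.lookup b w'" if "(w', w) \<in> r" "w' \<noteq> w" for w'
    using that w lin unfolding D_def order_on_defs antisym_def by blast
  moreover have "Poly_Mapping.lookup a w < Poly_Mapping.lookup b w \<or>
      Poly_Mapping.lookup a w > Poly_Mapping.lookup b w"
    using w(1) unfolding D_def by auto
  ultimately show ?thesis
    unfolding revlex_def by (metis linorder_less_linear)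
qed

text \<open>
  Antisymmetry of the order makes the greatest monomial unique, so that the definite description
  in the definition of \<open>initial_monomial\<close> denotes it.
\<close>

lemma initial_monomial_eq:
  assumes lin: "linear_order_on V r"
    and V: "\<And>m'. m' \<in> Poly_Mapping.keys f \<Longrightarrow> Poly_Mapping.keys m' \<subseteq> V"
    and m: "m \<in> Poly_Mapping.keys f"
    and max: "\<And>m'. m' \<in> Poly_Mapping.keys f \<Longrightarrow> m' \<noteq> m \<Longrightarrow> revlex r m' m"
  shows "initial_monomial (revlex r) f = Poly_Mapping.single m 1"
proof -
  have "(THE m. m \<in> Poly_Mapping.keys f \<and>
      (\<forall>m'\<in>Poly_Mapping.keys f. m' \<noteq> m \<longrightarrow> revlex r m' m)) = m"
  proof (rule the_equality)
    show "n = m" if n: "n \<in> Poly_Mapping.keys f \<and>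
        (\<forall>m'\<in>Poly_Mapping.keys f. m' \<noteq> n \<longrightarrow> revlex r m' n)" for n
    proof (rule ccontr)
      assume "n \<noteq> m"
      then have "revlex r n m" "revlex r m n"
        using n m max by auto
      then show False
        using revlex_trans[OF lin V[OF m] V] n revlex_irrefl by blast
    qed
  qed (use m max in auto)
  then show ?thesis
    unfolding initial_monomial_def by simp
qed

lemma initial_monomial_exists:
  assumes lin: "linear_order_on V r"
    and V: "\<And>m'. m' \<in> Poly_Mapping.keys f \<Longrightarrow> Poly_Mapping.keys m' \<subseteq> V"
    and "f \<noteq> 0"
  obtains m where "m \<in> Poly_Mapping.keys f"
    "\<And>m'. m' \<in> Poly_Mapping.keys f \<Longrightarrow> m' \<noteq> m \<Longrightarrow> revlex r m' m"
    "initial_monomial (revlex r) f = Poly_Mapping.single m 1"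
proof -
  have ne: "Poly_Mapping.keys f \<noteq> {}"
    using \<open>f \<noteq> 0\<close> by (metis (no_types, lifting) empty_iff in_keys_iff lookup_zero poly_mapping_eqI)
  have "transp_on (Poly_Mapping.keys f) (revlex r)" "totalp_on (Poly_Mapping.keys f) (revlex r)"
    using revlex_trans[OF lin V V] revlex_total[OF lin V V]
    unfolding transp_on_def totalp_on_def by blast+
  then obtain m where "m \<in> Poly_Mapping.keys f"
      "\<forall>m'\<in>Poly_Mapping.keys f. m' \<noteq> m \<longrightarrow> revlex r m' m"
    using Finite_Set.bex_greatest_element[of "Poly_Mapping.keys f" "revlex r"] ne by auto
  then show ?thesis
    using that initial_monomial_eq[OF lin V, where f = f and m = m] by blast
qed

lemma mdeg_add: "mdeg (u + v) = mdeg u + mdeg v"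
  unfolding mdeg_def by (rule setsum_keys_plus_distrib) auto

lemma revlex_add:
  assumes "revlex r u v"
  shows "revlex r (u + k) (v + k)"
  using assms unfolding revlex_def mdeg_add lookup_add by auto

text \<open>
  As \<open>\<pi>\<close> preserves degrees, this makes its fibres finite; it takes the place of the
  well-foundedness of a monomial order.
\<close>

lemma finite_monomials_of_degree:
  assumes "finite V"
  shows "finite {m :: 'v \<Rightarrow>\<^sub>0 nat. Poly_Mapping.keys m \<subseteq> V \<and> mdeg m = n}" (is "finite ?M")
proof -
  have "Poly_Mapping.lookup m v \<le> n" if "mdeg m = n" for m :: "'v \<Rightarrow>\<^sub>0 nat" and v
    using that member_le_sum[of v "Poly_Mapping.keys m" "Poly_Mapping.lookup m"]
    unfolding mdeg_def by (cases "v \<in> Poly_Mapping.keys m") (auto simp: in_keys_iff)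
  then have "Poly_Mapping.lookup ` ?M \<subseteq>
      {h. \<forall>v. (v \<in> V \<longrightarrow> h v \<in> {..n}) \<and> (v \<notin> V \<longrightarrow> h v = 0)}"
    by (auto simp: in_keys_iff subset_iff)
  then have "finite (Poly_Mapping.lookup ` ?M)"
    by (rule finite_subset) (rule finite_set_of_finite_funs[OF assms finite_atMost])
  then show ?thesis
    by (rule finite_imageD) (simp add: inj_on_def)
qed

section \<open>Exponents of images of monomials\<close>

text \<open>
  If every variable \<open>v\<close> is sent to \<open>t\<^sup>\<alpha> s\<close> with \<open>\<alpha> = e v\<close>, the monomial with exponent vector \<open>m\<close>
  is sent to the Laurent monomial with exponent \<open>image_exponent e m\<close>.
\<close>

definition image_exponent ::
  "('v \<Rightarrow> (nat \<Rightarrow>\<^sub>0 int)) \<Rightarrow> ('v \<Rightarrow>\<^sub>0 nat) \<Rightarrow> (nat \<Rightarrow>\<^sub>0 int) \<times> nat" where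
  "image_exponent e m =
     (\<Sum>v\<in>Poly_Mapping.keys m. frag_cmul (int (Poly_Mapping.lookup m v)) (e v), mdeg m)"

lemma image_exponent_add:
  "image_exponent e (u + v) = image_exponent e u + image_exponent e v"
proof -
  have "(\<Sum>x\<in>Poly_Mapping.keys (u + v). frag_cmul (int (Poly_Mapping.lookup (u + v) x)) (e x)) =
      (\<Sum>x\<in>Poly_Mapping.keys u. frag_cmul (int (Poly_Mapping.lookup u x)) (e x)) +
      (\<Sum>x\<in>Poly_Mapping.keys v. frag_cmul (int (Poly_Mapping.lookup v x)) (e x))"
    by (rule setsum_keys_plus_distrib) (auto simp: frag_cmul_distrib)
  then show ?thesis
    by (simp add: image_exponent_def mdeg_add)
qed

lemma image_exponent_single: "image_exponent e (Poly_Mapping.single v 1) = (e v, 1)"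
  by (simp add: image_exponent_def mdeg_def)

lemma t_s_power: "(t_s a :: 'k::field laurent) ^ n = Poly_Mapping.single (frag_cmul (int n) a, n) 1"
proof (induction n)
  case 0
  then show ?case by (simp add: zero_prod_def[symmetric])
next
  case (Suc n)
  have "a + frag_cmul (int n) a = frag_cmul (int (Suc n)) a"
    by (simp add: frag_cmul_distrib)
  then show ?case
    using Suc by (simp add: t_s_def mult_single)
qed

lemma subst_hom_t_s:
  assumes "\<And>m v. m \<in> Poly_Mapping.keys f \<Longrightarrow> v \<in> Poly_Mapping.keys m \<Longrightarrow> \<phi> v = t_s (e v)"
  shows "subst_hom \<phi> f =
    (\<Sum>m\<in>Poly_Mapping.keys f. Poly_Mapping.single (image_exponent e m) (Poly_Mapping.lookup f m))"
  unfolding subst_hom_def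
proof (rule sum.cong)
  fix m assume m: "m \<in> Poly_Mapping.keys f"
  have prod: "(\<Prod>v\<in>A. Poly_Mapping.single (g v) 1) = Poly_Mapping.single (sum g A) (1::'b)"
    if "finite A" for A :: "'a set" and g :: "'a \<Rightarrow> (nat \<Rightarrow>\<^sub>0 int) \<times> nat"
    using that by (induction A) (simp_all add: mult_single)
  have "(\<Prod>v\<in>Poly_Mapping.keys m. \<phi> v ^ Poly_Mapping.lookup m v) =
      (\<Prod>v\<in>Poly_Mapping.keys m. Poly_Mapping.single
        (frag_cmul (int (Poly_Mapping.lookup m v)) (e v), Poly_Mapping.lookup m v) 1)"
    using assms[OF m] by (intro prod.cong) (simp_all add: t_s_power)
  also have "\<dots> = Poly_Mapping.single (image_exponent e m) 1"
    by (simp add: prod image_exponent_def mdeg_def sum_prod)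
  finally show "Poly_Mapping.single 0 (Poly_Mapping.lookup f m) *
      (\<Prod>v\<in>Poly_Mapping.keys m. \<phi> v ^ Poly_Mapping.lookup m v) =
      Poly_Mapping.single (image_exponent e m) (Poly_Mapping.lookup f m)"
    by (simp add: mult_single)
qed simp

text \<open>
  The terms of \<open>f\<close> over one fibre cancel in the image, so no fibre contains exactly one of them.
\<close>

lemma kernel_keys_collide:
  assumes "(\<Sum>m\<in>Poly_Mapping.keys f. Poly_Mapping.single (E m) (Poly_Mapping.lookup f m)) = 0"
    and m: "m \<in> Poly_Mapping.keys f"
  shows "\<exists>m'\<in>Poly_Mapping.keys f. m' \<noteq> m \<and> E m' = E m"
proof (rule ccontr)
  assume contra: "\<not> ?thesis"
  have "0 = (\<Sum>m'\<in>Poly_Mapping.keys f.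
      Poly_Mapping.lookup (Poly_Mapping.single (E m') (Poly_Mapping.lookup f m')) (E m))"
    using assms(1) by (simp flip: lookup_sum)
  also have "\<dots> = (\<Sum>m'\<in>Poly_Mapping.keys f. if m' = m then Poly_Mapping.lookup f m else 0)"
    using contra by (intro sum.cong) (auto simp: lookup_single when_def)
  also have "\<dots> = Poly_Mapping.lookup f m"
    using m by simp
  finally show False
    using m by (simp add: in_keys_iff)
qed

lemma keys_binomial:
  assumes "u \<noteq> v"
  shows "Poly_Mapping.keys (Poly_Mapping.single u 1 - Poly_Mapping.single v (1::'k::field)) = {u, v}"
  using assms by (auto simp: in_keys_iff lookup_minus lookup_single when_def split: if_splits)

section \<open>A criterion for binomial bases of toric ideals\<close>

definition standard_monomial ::
  "'v rel \<Rightarrow> ('v, 'k::field) mpoly set \<Rightarrow> ('v \<Rightarrow>\<^sub>0 nat) \<Rightarrow> bool" where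
  "standard_monomial r G m \<longleftrightarrow>
     (\<forall>g\<in>G. \<forall>u k. initial_monomial (revlex r) g = Poly_Mapping.single u 1 \<longrightarrow> m \<noteq> u + k)"

text \<open>
  The conditions that put \<open>u - v\<close> into the kernel of \<open>\<pi>\<close> with initial monomial \<open>u\<close>.
\<close>

definition admissible_binomial ::
  "'v set \<Rightarrow> 'v rel \<Rightarrow> ('v \<Rightarrow> (nat \<Rightarrow>\<^sub>0 int)) \<Rightarrow> ('v \<Rightarrow>\<^sub>0 nat) \<Rightarrow> ('v \<Rightarrow>\<^sub>0 nat) \<Rightarrow> bool" where
  "admissible_binomial V r e u v \<longleftrightarrow> Poly_Mapping.keys u \<subseteq> V \<and> Poly_Mapping.keys v \<subseteq> V \<and>
     image_exponent e u = image_exponent e v \<and> revlex r v u"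

lemma admissible_binomial_neq: "admissible_binomial V r e u v \<Longrightarrow> u \<noteq> v"
  unfolding admissible_binomial_def using revlex_irrefl by blast

lemma initial_monomial_binomial:
  assumes "linear_order_on V r" "admissible_binomial V r e u v"
  shows "initial_monomial (revlex r) (Poly_Mapping.single u 1 - Poly_Mapping.single v (1::'k::field)) =
    Poly_Mapping.single u 1"
proof (rule initial_monomial_eq[OF assms(1)])
qed (use assms(2) in \<open>auto simp: keys_binomial[OF admissible_binomial_neq[OF assms(2)]]
  admissible_binomial_def\<close>)

text \<open>
  The smallest monomial of a fibre is standard, since dividing out an initial monomial \<open>u\<close> and
  multiplying by its partner \<open>v\<close> leads to a smaller monomial of the same fibre.
\<close>

lemma exists_standard_monomial:
  assumes fin: "finite V" and lin: "linear_order_on V r"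
    and G: "\<And>g. g \<in> G \<Longrightarrow> \<exists>u v. g = Poly_Mapping.single u 1 - Poly_Mapping.single v 1 \<and>
      admissible_binomial V r e u v"
    and m: "Poly_Mapping.keys m \<subseteq> V"
  obtains n where "Poly_Mapping.keys n \<subseteq> V" "image_exponent e n = image_exponent e m"
    "standard_monomial r (G :: ('v, 'k::field) mpoly set) n"
    "\<And>m'. Poly_Mapping.keys m' \<subseteq> V \<Longrightarrow> image_exponent e m' = image_exponent e n \<Longrightarrow> \<not> revlex r m' n"
proof -
  define F where "F = {n. Poly_Mapping.keys n \<subseteq> V \<and> image_exponent e n = image_exponent e m}"
  have "F \<subseteq> {n. Poly_Mapping.keys n \<subseteq> V \<and> mdeg n = mdeg m}"
    unfolding F_def image_exponent_def by auto
  then have "finite F"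
    using finite_monomials_of_degree[OF fin] finite_subset by blast
  moreover have "F \<noteq> {}"
    using m unfolding F_def by blast
  moreover have "transp_on F (revlex r)"
    using revlex_trans[OF lin] unfolding transp_on_def F_def by blast
  moreover have "asymp_on F (revlex r)"
    using revlex_trans[OF lin] revlex_irrefl unfolding asymp_on_def F_def by blast
  ultimately obtain n where n: "n \<in> F" "\<forall>m'\<in>F. m' \<noteq> n \<longrightarrow> \<not> revlex r m' n"
    using Finite_Set.bex_min_element[of F "revlex r"] by blast
  then have min: "\<not> revlex r m' n" if "m' \<in> F" for m'
    using that revlex_irrefl[of r n] by (cases "m' = n") auto
  have "standard_monomial r G n"
    unfolding standard_monomial_def
  proof (intro ballI allI impI notI)
    fix g u k
    assume g: "g \<in> G" "initial_monomial (revlex r) g = Poly_Mapping.single u 1" and nk: "n = u + k"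
    obtain u' v where uv: "g = Poly_Mapping.single u' 1 - Poly_Mapping.single v 1"
        "admissible_binomial V r e u' v"
      using G[OF g(1)] by blast
    have "u' = u"
      using g(2) initial_monomial_binomial[OF lin uv(2)] uv(1)
      by (metis keys_single one_neq_zero the_elem_eq)
    have "Poly_Mapping.keys (v + k) \<subseteq> V"
    proof -
      have "Poly_Mapping.keys k \<subseteq> Poly_Mapping.keys n"
        unfolding nk by (auto simp: in_keys_iff lookup_add)
      then show ?thesis
        using n(1) uv(2) keys_add[of v k] unfolding F_def admissible_binomial_def by blast
    qed
    moreover have "image_exponent e (v + k) = image_exponent e n"
      using uv(2) \<open>u' = u\<close> unfolding nk image_exponent_add admissible_binomial_def by simp
    ultimately have "v + k \<in> F"
      using n(1) unfolding F_def by simp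
    moreover have "revlex r (v + k) n"
      using uv(2) \<open>u' = u\<close> revlex_add unfolding nk admissible_binomial_def by blast
    ultimately show False
      using min by blast
  qed
  then show ?thesis
    using that n(1) min unfolding F_def by (metis (mono_tags, lifting) mem_Collect_eq)
qed

text \<open>
  For \<open>f\<close> in the kernel with initial monomial \<open>m\<close>, some smaller monomial of \<open>f\<close> has the same image
  as \<open>m\<close>. So \<open>m\<close> is not the smallest monomial of its fibre. That smallest monomial is standard,
  and as it is the only standard one there, \<open>m\<close> is not standard.
\<close>

lemma groebner_basis_criterion:
  fixes G :: "('v, 'k::field) mpoly set"
  assumes fin: "finite V" and lin: "linear_order_on V r" and finG: "finite G"
    and \<phi>: "\<And>v. v \<in> V \<Longrightarrow> \<phi> v = t_s (e v)"
    and G: "\<And>g. g \<in> G \<Longrightarrow> \<exists>u v. g = Poly_Mapping.single u 1 - Poly_Mapping.single v 1 \<and>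
      admissible_binomial V r e u v"
    and std: "\<And>m m'. Poly_Mapping.keys m \<subseteq> V \<Longrightarrow> Poly_Mapping.keys m' \<subseteq> V \<Longrightarrow>
      image_exponent e m = image_exponent e m' \<Longrightarrow>
      standard_monomial r G m \<Longrightarrow> standard_monomial r G m' \<Longrightarrow> m = m'"
  shows "groebner_basis V (revlex r) {f \<in> carrier (mpoly_ring V). subst_hom \<phi> f = 0} G"
proof -
  define K where "K = {f \<in> carrier (mpoly_ring V :: ('v, 'k) mpoly ring). subst_hom \<phi> f = 0}"
  have subst: "subst_hom \<phi> f = (\<Sum>m\<in>Poly_Mapping.keys f.
      Poly_Mapping.single (image_exponent e m) (Poly_Mapping.lookup f m))"
    if "f \<in> carrier (mpoly_ring V)" for f :: "('v, 'k) mpoly"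
    using that \<phi> by (intro subst_hom_t_s) (auto simp: mpoly_ring_def subset_iff)
  have GK: "G \<subseteq> K - {0}"
  proof
    fix g assume "g \<in> G"
    then obtain u v where g: "g = Poly_Mapping.single u 1 - Poly_Mapping.single v 1"
        and uv: "admissible_binomial V r e u v"
      using G by blast
    have "u \<noteq> v"
      by (rule admissible_binomial_neq[OF uv])
    then have keys: "Poly_Mapping.keys g = {u, v}"
      unfolding g by (rule keys_binomial)
    have carr: "g \<in> carrier (mpoly_ring V)"
      using uv keys by (auto simp: mpoly_ring_def admissible_binomial_def)
    have "subst_hom \<phi> g = 0"
      using uv \<open>u \<noteq> v\<close> unfolding subst[OF carr] keys admissible_binomial_def
      by (simp add: g lookup_minus lookup_single when_def single_uminus)
    moreover have "g \<noteq> 0"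
      using keys by auto
    ultimately show "g \<in> K - {0}"
      unfolding K_def using carr by simp
  qed
  have divides: "\<exists>g\<in>G. \<exists>u k. initial_monomial (revlex r) g = Poly_Mapping.single u 1 \<and>
      Poly_Mapping.keys k \<subseteq> V \<and> initial_monomial (revlex r) f = Poly_Mapping.single (k + u) 1"
    if f: "f \<in> K - {0}" for f
  proof -
    have carr: "f \<in> carrier (mpoly_ring V)" and V: "\<And>m. m \<in> Poly_Mapping.keys f \<Longrightarrow> Poly_Mapping.keys m \<subseteq> V"
      using f unfolding K_def mpoly_ring_def by auto
    obtain m where m: "m \<in> Poly_Mapping.keys f"
        "\<And>m'. m' \<in> Poly_Mapping.keys f \<Longrightarrow> m' \<noteq> m \<Longrightarrow> revlex r m' m"
        "initial_monomial (revlex r) f = Poly_Mapping.single m 1"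
      using initial_monomial_exists[OF lin V] f by blast
    have "subst_hom \<phi> f = 0"
      using f unfolding K_def by simp
    then obtain m' where m': "m' \<in> Poly_Mapping.keys f" "m' \<noteq> m" "image_exponent e m' = image_exponent e m"
      using kernel_keys_collide[OF _ m(1)] unfolding subst[OF carr] by blast
    obtain n where n: "Poly_Mapping.keys n \<subseteq> V" "image_exponent e n = image_exponent e m"
        "standard_monomial r G n"
        "\<And>m'. Poly_Mapping.keys m' \<subseteq> V \<Longrightarrow> image_exponent e m' = image_exponent e n \<Longrightarrow> \<not> revlex r m' n"
      using exists_standard_monomial[OF fin lin G V[OF m(1)]] by blast
    have "n \<noteq> m"
      using n(4)[OF V[OF m'(1)]] m'(3) m(2)[OF m'(1,2)] by auto
    then have "\<not> standard_monomial r G m"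
      using std[OF n(1) V[OF m(1)] n(2,3)] by blast
    then obtain g u k where g: "g \<in> G" "initial_monomial (revlex r) g = Poly_Mapping.single u 1" "m = u + k"
      unfolding standard_monomial_def by blast
    have "Poly_Mapping.keys k \<subseteq> Poly_Mapping.keys m"
      unfolding g(3) by (auto simp: in_keys_iff lookup_add)
    then show ?thesis
      using g(1,2) m(3) V[OF m(1)] unfolding g(3) add.commute[of u k]
      by (intro bexI[OF _ g(1)] exI[of _ u] exI[of _ k]) auto
  qed
  have "initial_monomial (revlex r) ` (K - {0}) \<subseteq> I"
    if I: "ideal I (mpoly_ring V)" "initial_monomial (revlex r) ` G \<subseteq> I" for I
  proof
    fix h assume "h \<in> initial_monomial (revlex r) ` (K - {0})"
    then obtain f where "f \<in> K - {0}" "h = initial_monomial (revlex r) f"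
      by blast
    with divides[of f] obtain g u k where g: "g \<in> G" "initial_monomial (revlex r) g = Poly_Mapping.single u 1"
        "Poly_Mapping.keys k \<subseteq> V" "h = Poly_Mapping.single (k + u) 1"
      by auto
    have "Poly_Mapping.single u 1 \<in> I"
      using I(2) imageI[OF g(1), of "initial_monomial (revlex r)"] unfolding g(2) by blast
    moreover have "Poly_Mapping.single k 1 \<in> carrier (mpoly_ring V :: ('v, 'k) mpoly ring)"
      using g(3) by (simp add: mpoly_ring_def)
    ultimately have "Poly_Mapping.single k 1 \<otimes>\<^bsub>mpoly_ring V\<^esub> Poly_Mapping.single u 1 \<in> I"
      by (rule ideal.I_l_closed[OF I(1)])
    then show "h \<in> I"
      unfolding g(4) by (simp add: mpoly_ring_def mult_single)
  qed
  moreover have "initial_monomial (revlex r) ` G \<subseteq> initial_monomial (revlex r) ` (K - {0})"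
    by (rule image_mono[OF GK])
  ultimately have "{I. ideal I (mpoly_ring V) \<and> initial_monomial (revlex r) ` (K - {0}) \<subseteq> I} =
      {I. ideal I (mpoly_ring V) \<and> initial_monomial (revlex r) ` G \<subseteq> I}"
    by (intro Collect_cong conj_cong refl iffI) (rule order_trans, assumption+)
  then have "Idl\<^bsub>mpoly_ring V\<^esub> (initial_monomial (revlex r) ` (K - {0})) =
      Idl\<^bsub>mpoly_ring V\<^esub> (initial_monomial (revlex r) ` G)"
    unfolding genideal_def by (rule arg_cong)
  then show ?thesis
    using finG GK unfolding groebner_basis_def K_def by simp
qed

section \<open>Multisets of sets that form a chain\<close>

text \<open>
  A function \<open>f\<close> on a family \<open>A\<close> of sets stands for a multiset of members of \<open>A\<close>, that is, for the
  part of a monomial that involves only the variables \<open>x\<^sub>I\<close>, or only the variables \<open>y\<^sub>J\<close>.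
\<close>

definition cover_count :: "'a set set \<Rightarrow> ('a set \<Rightarrow> nat) \<Rightarrow> 'a \<Rightarrow> nat" where
  "cover_count A f x = (\<Sum>I | I \<in> A \<and> x \<in> I. f I)"

definition chain_supported :: "'a set set \<Rightarrow> ('a set \<Rightarrow> nat) \<Rightarrow> bool" where
  "chain_supported A f \<longleftrightarrow>
     (\<forall>I\<in>A. \<forall>J\<in>A. f I \<noteq> 0 \<longrightarrow> f J \<noteq> 0 \<longrightarrow> I \<subseteq> J \<or> J \<subseteq> I)"

text \<open>
  On sets with more elements than \<open>I\<close> the multisets \<open>f\<close> and \<open>g\<close> agree, and those that occur contain
  \<open>I\<close>, because \<open>I\<close> occurs in \<open>f\<close> and \<open>f\<close> is supported on a chain. The sets other than \<open>I\<close> that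
  occur in \<open>g\<close> and have at most as many elements as \<open>I\<close> form a chain. If there are any, their union
  is one of them and so cannot contain \<open>I\<close>; hence some point \<open>x\<close> of \<open>I\<close> lies in none of them. At \<open>x\<close>,
  only \<open>I\<close> and the sets with more elements contribute to \<open>g\<close>, and \<open>I\<close> contributes more to \<open>f\<close>.
\<close>

lemma cover_count_less:
  assumes A: "finite A" "\<And>I. I \<in> A \<Longrightarrow> finite I" "{} \<notin> A"
    and f: "chain_supported A f" and g: "chain_supported A g"
    and I: "I \<in> A" "g I < f I"
    and larger: "\<And>J. J \<in> A \<Longrightarrow> card I < card J \<Longrightarrow> f J = g J"
  shows "\<exists>x\<in>I. cover_count A g x < cover_count A f x"
proof -
  define L where "L = {J \<in> A. g J \<noteq> 0 \<and> card J \<le> card I \<and> J \<noteq> I}"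
  obtain x where x: "x \<in> I" "\<And>J. J \<in> L \<Longrightarrow> x \<notin> J"
  proof (cases "L = {}")
    case True
    then show thesis
      using that A(3) I(1) by (metis ex_in_conv)
  next
    case False
    have "finite L"
      using A(1) unfolding L_def by simp
    then have "Max (card ` L) \<in> card ` L"
      using False by simp
    then obtain M where M: "M \<in> L" "Max (card ` L) = card M"
      by blast
    have top: "J \<subseteq> M" if "J \<in> L" for J
    proof -
      have "card J \<le> card M"
        using that M(2) \<open>finite L\<close> by (metis Max_ge finite_imageI imageI)
      moreover have "J \<subseteq> M \<or> M \<subseteq> J" "finite J"
        using that M(1) g A(2) unfolding L_def chain_supported_def by blast+
      ultimately show ?thesis
        by (metis card_seteq order_refl)
    qed
    have "\<not> I \<subseteq> M"
      using M(1) A(2) card_seteq[of M I] unfolding L_def by auto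
    then show thesis
      using that top by blast
  qed
  define H where "H = {J \<in> A. card I < card J \<and> f J \<noteq> 0}"
  have H: "finite H" "I \<notin> H" "H \<subseteq> A"
    using A(1) unfolding H_def by auto
  have "x \<in> J" if "J \<in> H" for J
  proof -
    have "\<not> J \<subseteq> I"
      using that card_mono[OF A(2)[OF I(1)], of J] unfolding H_def by auto
    moreover have "J \<in> A" "f J \<noteq> 0" "f I \<noteq> 0"
      using that I(2) unfolding H_def by auto
    ultimately have "I \<subseteq> J"
      using f I(1) unfolding chain_supported_def by blast
    then show ?thesis
      using x(1) by blast
  qed
  then have sub: "insert I H \<subseteq> {J. J \<in> A \<and> x \<in> J}"
    using H(3) I(1) x(1) by blast
  have "cover_count A g x = sum g {J. J \<in> A \<and> x \<in> J}"
    by (simp add: cover_count_def)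
  also have "\<dots> = sum g (insert I H)"
  proof (rule sum.mono_neutral_right[OF _ sub])
    show "\<forall>J\<in>{J. J \<in> A \<and> x \<in> J} - insert I H. g J = 0"
    proof (intro ballI)
      fix J assume J: "J \<in> {J. J \<in> A \<and> x \<in> J} - insert I H"
      have "J \<notin> L"
        using J x(2) by blast
      then show "g J = 0"
        using J larger[of J] unfolding L_def H_def by (auto simp: not_le)
    qed
  qed (use A(1) in simp)
  also have "\<dots> = g I + sum g H"
    using H by simp
  also have "\<dots> = g I + sum f H"
    using larger unfolding H_def by simp
  also have "\<dots> < f I + sum f H"
    using I(2) by simp
  also have "\<dots> = sum f (insert I H)"
    using H by simp
  also have "\<dots> \<le> sum f {J. J \<in> A \<and> x \<in> J}"
    using A(1) by (intro sum_mono2[OF _ sub]) auto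
  also have "\<dots> = cover_count A f x"
    by (simp add: cover_count_def)
  finally show ?thesis
    using x(1) by blast
qed

text \<open>
  Otherwise \<open>cover_count_less\<close> applies to a set of largest cardinality at which the two multisets
  differ.
\<close>

lemma chain_supported_unique:
  assumes A: "finite A" "\<And>I. I \<in> A \<Longrightarrow> finite I" "{} \<notin> A"
    and f: "chain_supported A f" and g: "chain_supported A g"
    and eq: "\<And>I x. I \<in> A \<Longrightarrow> x \<in> I \<Longrightarrow> cover_count A f x = cover_count A g x"
    and "I \<in> A"
  shows "f I = g I"
proof (rule ccontr)
  assume neq: "f I \<noteq> g I"
  define D where "D = {J \<in> A. f J \<noteq> g J}"
  have "finite D" "D \<noteq> {}"
    using A(1) \<open>I \<in> A\<close> neq unfolding D_def by auto
  then have "Max (card ` D) \<in> card ` D"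
    by simp
  then obtain M where M: "M \<in> D" "Max (card ` D) = card M"
    by blast
  have larger: "f J = g J" if "J \<in> A" "card M < card J" for J
  proof (rule ccontr)
    assume "f J \<noteq> g J"
    then have "card J \<le> Max (card ` D)"
      using that(1) \<open>finite D\<close> unfolding D_def by simp
    then show False
      using that(2) M(2) by simp
  qed
  have M': "M \<in> A" "f M < g M \<or> g M < f M"
    using M(1) unfolding D_def by auto
  from M'(2) have "\<exists>x\<in>M. cover_count A f x \<noteq> cover_count A g x"
  proof
    assume "f M < g M"
    from cover_count_less[OF A g f M'(1) this larger[symmetric]]
    show ?thesis by force
  next
    assume "g M < f M"
    from cover_count_less[OF A f g M'(1) this larger]
    show ?thesis by force
  qed
  then show False
    using eq M'(1) by blast
qed

lemma cover_count_antimono: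
  assumes "finite A" "A \<subseteq> poset_ideals P r" "x \<in> P" "(x, y) \<in> r"
  shows "cover_count A f y \<le> cover_count A f x"
  unfolding cover_count_def
proof (rule sum_mono2)
  have "x \<in> I" if "I \<in> A" "y \<in> I" for I
    using that assms(2-4) unfolding poset_ideals_def by auto
  then show "{I. I \<in> A \<and> y \<in> I} \<subseteq> {I. I \<in> A \<and> x \<in> I}"
    by blast
qed (use assms in auto)

text \<open>
  In the chain, take the smallest member \<open>I\<close> that contains \<open>x\<close>. If \<open>I\<close> contained some \<open>y > x\<close>, then
  so would every member containing \<open>x\<close>, and \<open>y\<close> would be covered at least as often as \<open>x\<close>.
\<close>

lemma maximal_in_chain_member:
  assumes A: "finite A" "A \<subseteq> poset_ideals P r" "\<And>I. I \<in> A \<Longrightarrow> finite I"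
    and f: "chain_supported A f"
    and pos: "0 < cover_count A f x"
    and above: "\<And>y. y \<in> P \<Longrightarrow> (x, y) \<in> r \<Longrightarrow> y \<noteq> x \<Longrightarrow> cover_count A f y < cover_count A f x"
  shows "\<exists>I\<in>A. f I \<noteq> 0 \<and> maximal_in r I x"
proof -
  define C where "C = {I \<in> A. x \<in> I \<and> f I \<noteq> 0}"
  have "finite C"
    using A(1) unfolding C_def by simp
  have "cover_count A f x = sum f C"
    unfolding cover_count_def C_def using A(1) by (intro sum.mono_neutral_right) auto
  then have "C \<noteq> {}"
    using pos by auto
  then have "Min (card ` C) \<in> card ` C"
    using \<open>finite C\<close> by simp
  then obtain I where I: "I \<in> C" "Min (card ` C) = card I"
    by blast
  have least: "I \<subseteq> J" if "J \<in> C" for J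
  proof -
    have "card I \<le> card J"
      using that I(2) \<open>finite C\<close> by (metis Min_le finite_imageI imageI)
    moreover have "J \<subseteq> I \<or> I \<subseteq> J" "finite I"
      using that I(1) f A(3) unfolding C_def chain_supported_def by blast+
    ultimately show ?thesis
      by (metis card_seteq order_refl)
  qed
  have "y = x" if y: "y \<in> I" "(x, y) \<in> r" for y
  proof (rule ccontr)
    assume "y \<noteq> x"
    have "y \<in> P"
      using y(1) I(1) A(2) unfolding C_def poset_ideals_def by blast
    have "sum f C \<le> cover_count A f y"
      unfolding cover_count_def
      using A(1) least y(1) by (intro sum_mono2) (auto simp: C_def)
    then show False
      using above[OF \<open>y \<in> P\<close> y(2) \<open>y \<noteq> x\<close>] \<open>cover_count A f x = sum f C\<close> by simp
  qed
  then show ?thesis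
    using I(1) unfolding C_def maximal_in_def by blast
qed

section \<open>Quadratic monomials\<close>

abbreviation pair_monomial :: "'v \<Rightarrow> 'v \<Rightarrow> ('v \<Rightarrow>\<^sub>0 nat)" where
  "pair_monomial a b \<equiv> Poly_Mapping.single a 1 + Poly_Mapping.single b 1"

lemma keys_pair_monomial: "Poly_Mapping.keys (pair_monomial a b) = {a, b}"
  by (auto simp: in_keys_iff lookup_add lookup_single when_def split: if_splits)

lemma pair_monomial_divides:
  fixes m :: "'v \<Rightarrow>\<^sub>0 nat"
  assumes "a \<noteq> b" "Poly_Mapping.lookup m a \<noteq> 0" "Poly_Mapping.lookup m b \<noteq> 0"
  shows "m = pair_monomial a b + (m - pair_monomial a b)"
  using assms by (intro poly_mapping_eqI) (auto simp: lookup_add lookup_minus lookup_single when_def)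

text \<open>
  The smaller of \<open>w\<close> and \<open>c\<close> decides the comparison: it is smaller than both \<open>a\<close> and \<open>b\<close> as \<open>w\<close> is.
  The position of \<open>c\<close> is left open, because for incomparable ideals the variable of \<open>I \<inter> I'\<close> is
  smaller than those of \<open>I\<close> and \<open>I'\<close>, while the variable of \<open>I \<union> I'\<close> is larger.
\<close>

lemma revlex_pair_monomial:
  assumes lin: "linear_order_on V r" and V: "w \<in> V" "c \<in> V"
    and wa: "(w, a) \<in> r" "w \<noteq> a" and wb: "(w, b) \<in> r" "w \<noteq> b"
  shows "revlex r (pair_monomial w c) (pair_monomial a b)"
proof -
  have tr: "\<And>x y z. (x, y) \<in> r \<Longrightarrow> (y, z) \<in> r \<Longrightarrow> (x, z) \<in> r"
    and an: "\<And>x y. (x, y) \<in> r \<Longrightarrow> (y, x) \<in> r \<Longrightarrow> x = y"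
    and tot: "w = c \<or> (w, c) \<in> r \<or> (c, w) \<in> r"
    using lin V unfolding order_on_defs trans_def antisym_def total_on_def by blast+
  obtain z where z: "z = w \<or> z = c" "z = w \<or> (z, w) \<in> r" "z = c \<or> (z, c) \<in> r"
    using tot by blast
  have za: "(z, a) \<in> r" "z \<noteq> a" and zb: "(z, b) \<in> r" "z \<noteq> b"
    using z(2) wa wb tr an by metis+
  have low: "w' \<noteq> a \<and> w' \<noteq> b \<and> w' \<noteq> w \<and> w' \<noteq> c" if "(w', z) \<in> r" "w' \<noteq> z" for w'
    using that z za zb an by metis
  have "Poly_Mapping.lookup (pair_monomial w c) z > Poly_Mapping.lookup (pair_monomial a b) z"
    using z(1) za zb by (auto simp: lookup_add lookup_single when_def)
  moreover have "Poly_Mapping.lookup (pair_monomial w c) w' = Poly_Mapping.lookup (pair_monomial a b) w'"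
    if "(w', z) \<in> r" "w' \<noteq> z" for w'
    using low[OF that] by (auto simp: lookup_add lookup_single when_def)
  moreover have "mdeg (pair_monomial w c) = mdeg (pair_monomial a b)"
    unfolding mdeg_add by (simp add: mdeg_def)
  ultimately show ?thesis
    unfolding revlex_def by blast
qed

text \<open>
  The smaller of \<open>a'\<close> and \<open>b'\<close> is smaller than both \<open>a\<close> and \<open>b\<close>. This serves the products \<open>x\<^sub>I y\<^sub>J\<close>,
  where \<open>x\<close>-variables are only known to compare with \<open>x\<close>-variables and \<open>y\<close>-variables with
  \<open>y\<close>-variables.
\<close>

lemma revlex_pair_monomial_both:
  assumes lin: "linear_order_on V r" and V: "a' \<in> V" "b' \<in> V"
    and a: "(a', a) \<in> r" "a' \<noteq> a" and b: "(b', b) \<in> r" "b' \<noteq> b"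
  shows "revlex r (pair_monomial a' b') (pair_monomial a b)"
proof -
  have tr: "\<And>x y z. (x, y) \<in> r \<Longrightarrow> (y, z) \<in> r \<Longrightarrow> (x, z) \<in> r"
    and an: "\<And>x y. (x, y) \<in> r \<Longrightarrow> (y, x) \<in> r \<Longrightarrow> x = y"
    and tot: "a' = b' \<or> (a', b') \<in> r \<or> (b', a') \<in> r"
    using lin V unfolding order_on_defs trans_def antisym_def total_on_def by blast+
  show ?thesis
  proof (cases "a' = b' \<or> (a', b') \<in> r")
    case True
    then have "(a', b) \<in> r" "a' \<noteq> b"
      using b tr an by metis+
    then show ?thesis
      by (rule revlex_pair_monomial[OF lin V a])
  next
    case False
    then have "(b', a) \<in> r" "b' \<noteq> a"
      using a tr an tot by metis+
    then have "revlex r (pair_monomial b' a') (pair_monomial a b)"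
      using revlex_pair_monomial[OF lin V(2) V(1)] b by blast
    then show ?thesis
      by (simp only: add.commute)
  qed
qed

section \<open>The exponents of the toric ring of two posets\<close>

fun var_exponent :: "nat \<Rightarrow> (nat \<Rightarrow> 'a) \<Rightarrow> (nat \<Rightarrow> 'b) \<Rightarrow> ('a, 'b) toric_var \<Rightarrow> (nat \<Rightarrow>\<^sub>0 int)" where
  "var_exponent d p q (Xvar I) = rho d p I"
| "var_exponent d p q (Yvar J) = - rho d q J"
| "var_exponent d p q Zvar = 0"

lemma pi_var_eq_t_s: "pi_var d p q v = t_s (var_exponent d p q v)"
  by (cases v) simp_all

lemma lookup_rho:
  "Poly_Mapping.lookup (rho d p I) i = (if i \<in> {1..d} \<and> p i \<in> I then 1 else 0)"
  unfolding rho_def lookup_sum by (simp add: lookup_single when_def)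

lemma rho_empty: "rho d p {} = 0"
  by (intro poly_mapping_eqI) (simp add: lookup_rho)

lemma rho_Int_Un: "rho d p I + rho d p I' = rho d p (I \<inter> I') + rho d p (I \<union> I')"
  by (intro poly_mapping_eqI) (auto simp: lookup_add lookup_rho)

lemma rho_remove:
  assumes "inj_on p {1..d}" "i \<in> {1..d}" "p i \<in> I"
  shows "rho d p I = rho d p (I - {p i}) + Poly_Mapping.single i 1"
proof (rule poly_mapping_eqI)
  fix k
  show "Poly_Mapping.lookup (rho d p I) k =
      Poly_Mapping.lookup (rho d p (I - {p i}) + Poly_Mapping.single i 1) k"
    using assms by (cases "k = i")
      (auto simp: lookup_add lookup_rho lookup_single when_def dest: inj_onD)
qed

lemma sum_keys_superset:
  assumes "finite V" "Poly_Mapping.keys m \<subseteq> V" "\<And>v. Poly_Mapping.lookup m v = 0 \<Longrightarrow> h v = 0"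
  shows "sum h (Poly_Mapping.keys m) = sum h V"
  using assms by (intro sum.mono_neutral_left) (auto simp: in_keys_iff)

lemma sum_toric_var:
  fixes h :: "('a, 'b) toric_var \<Rightarrow> 'c::comm_monoid_add"
  assumes "finite A" "finite B"
  shows "sum h (Xvar ` A \<union> Yvar ` B \<union> {Zvar}) =
    (\<Sum>I\<in>A. h (Xvar I)) + (\<Sum>J\<in>B. h (Yvar J)) + h Zvar"
proof -
  have "sum h (Xvar ` A \<union> Yvar ` B \<union> {Zvar}) = sum h (Xvar ` A) + sum h (Yvar ` B) + h Zvar"
    using assms by (subst sum.union_disjoint | auto)+
  then show ?thesis
    by (simp add: sum.reindex inj_on_def)
qed

text \<open>
  The coordinates of the image of a monomial are the differences \<open>\<alpha>\<^sub>i - \<beta>\<^sub>i\<close>.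
\<close>

lemma var_exponent_lookup_sum:
  assumes fin: "finite A" "finite B" and m: "Poly_Mapping.keys m \<subseteq> Xvar ` A \<union> Yvar ` B \<union> {Zvar}"
    and i: "i \<in> {1..d}"
  shows "Poly_Mapping.lookup (fst (image_exponent (var_exponent d p q) m)) i =
    int (cover_count A (\<lambda>I. Poly_Mapping.lookup m (Xvar I)) (p i)) -
    int (cover_count B (\<lambda>J. Poly_Mapping.lookup m (Yvar J)) (q i))"
proof -
  have "Poly_Mapping.lookup (fst (image_exponent (var_exponent d p q) m)) i =
      (\<Sum>v\<in>Poly_Mapping.keys m.
        int (Poly_Mapping.lookup m v) * Poly_Mapping.lookup (var_exponent d p q v) i)"
    by (simp add: image_exponent_def lookup_sum)
  also have "\<dots> = (\<Sum>v\<in>Xvar ` A \<union> Yvar ` B \<union> {Zvar}.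
        int (Poly_Mapping.lookup m v) * Poly_Mapping.lookup (var_exponent d p q v) i)"
    using fin m by (intro sum_keys_superset) auto
  also have "\<dots> = (\<Sum>I\<in>A. if p i \<in> I then int (Poly_Mapping.lookup m (Xvar I)) else 0) -
      (\<Sum>J\<in>B. if q i \<in> J then int (Poly_Mapping.lookup m (Yvar J)) else 0)"
    unfolding sum_toric_var[OF fin] using i
    by (simp add: lookup_rho if_distrib sum_negf[symmetric] cong: if_cong)
  also have "\<dots> = int (cover_count A (\<lambda>I. Poly_Mapping.lookup m (Xvar I)) (p i)) -
      int (cover_count B (\<lambda>J. Poly_Mapping.lookup m (Yvar J)) (q i))"
    using fin unfolding cover_count_def by (simp flip: sum.inter_filter)
  finally show ?thesis .
qed

lemma mdeg_toric_var:
  assumes fin: "finite A" "finite B" and m: "Poly_Mapping.keys m \<subseteq> Xvar ` A \<union> Yvar ` B \<union> {Zvar}"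
  shows "mdeg m = (\<Sum>I\<in>A. Poly_Mapping.lookup m (Xvar I)) +
    (\<Sum>J\<in>B. Poly_Mapping.lookup m (Yvar J)) + Poly_Mapping.lookup m Zvar"
proof -
  have "mdeg m = sum (Poly_Mapping.lookup m) (Xvar ` A \<union> Yvar ` B \<union> {Zvar})"
    unfolding mdeg_def using fin m by (intro sum_keys_superset) auto
  then show ?thesis
    by (simp only: sum_toric_var[OF fin])
qed

lemma poset_ideals_Int_Un:
  assumes "I \<in> poset_ideals P r" "I' \<in> poset_ideals P r"
  shows "I \<inter> I' \<in> poset_ideals P r" "I \<union> I' \<in> poset_ideals P r"
  using assms unfolding poset_ideals_def by auto

lemma poset_ideals_remove_maximal:
  assumes "I \<in> poset_ideals P r" "maximal_in r I x"
  shows "I - {x} \<in> poset_ideals P r"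
  using assms unfolding poset_ideals_def maximal_in_def by auto

section \<open>Two posets with a common linear extension\<close>

text \<open>
  The common linear extension \<open>\<sigma>\<close> is fixed here, because the main argument singles out the last
  label along it.
\<close>

locale common_linear_extension =
  fixes d :: nat
    and P :: "'a set" and rP :: "'a rel" and p :: "nat \<Rightarrow> 'a"
    and Q :: "'b set" and rQ :: "'b rel" and q :: "nat \<Rightarrow> 'b"
    and var_le :: "('a, 'b) toric_var rel" and \<sigma> :: "nat \<Rightarrow> nat"
  assumes P: "labelled_poset d P rP p"
    and Q: "labelled_poset d Q rQ q"
    and var_order: "linear_order_on (toric_vars P rP Q rQ) var_le"
    and Zvar_le_Xvar: "\<And>I. I \<in> poset_ideals P rP \<Longrightarrow> I \<noteq> {} \<Longrightarrow> (Zvar, Xvar I) \<in> var_le"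
    and Zvar_le_Yvar: "\<And>J. J \<in> poset_ideals Q rQ \<Longrightarrow> J \<noteq> {} \<Longrightarrow> (Zvar, Yvar J) \<in> var_le"
    and Xvar_le: "\<And>I I'. I \<in> poset_ideals P rP \<Longrightarrow> I' \<in> poset_ideals P rP \<Longrightarrow>
           I' \<noteq> {} \<Longrightarrow> I' \<subset> I \<Longrightarrow> (Xvar I', Xvar I) \<in> var_le"
    and Yvar_le: "\<And>J J'. J \<in> poset_ideals Q rQ \<Longrightarrow> J' \<in> poset_ideals Q rQ \<Longrightarrow>
           J' \<noteq> {} \<Longrightarrow> J' \<subset> J \<Longrightarrow> (Yvar J', Yvar J) \<in> var_le"
    and \<sigma>P: "linear_extension d rP p \<sigma>"
    and \<sigma>Q: "linear_extension d rQ q \<sigma>"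
begin

abbreviation "vars \<equiv> toric_vars P rP Q rQ"
abbreviation "idealsP \<equiv> poset_ideals P rP - {{}}"
abbreviation "idealsQ \<equiv> poset_ideals Q rQ - {{}}"
abbreviation "exponent \<equiv> var_exponent d p q"
abbreviation "countP m \<equiv> cover_count idealsP (\<lambda>I. Poly_Mapping.lookup m (Xvar I))"
abbreviation "countQ m \<equiv> cover_count idealsQ (\<lambda>J. Poly_Mapping.lookup m (Yvar J))"

text \<open>
  The variables of ideals under the convention \<open>x\<^sub>\<emptyset> = y\<^sub>\<emptyset> = z\<close>. It is compatible with the order on
  the variables, as \<open>z\<close> is the smallest one, and with \<open>\<pi>\<close>, as \<open>\<rho> \<emptyset> = 0\<close>.
\<close>

definition xv :: "'a set \<Rightarrow> ('a, 'b) toric_var" where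
  "xv I = (if I = {} then Zvar else Xvar I)"

definition yv :: "'b set \<Rightarrow> ('a, 'b) toric_var" where
  "yv J = (if J = {} then Zvar else Yvar J)"

lemma vars_eq: "vars = Xvar ` idealsP \<union> Yvar ` idealsQ \<union> {Zvar}"
  by (simp add: toric_vars_def)

lemma finite_posets: "finite P" "finite Q"
  using P Q bij_betw_finite unfolding labelled_poset_def by blast+

lemma finite_ideals: "finite (poset_ideals P rP)" "finite (poset_ideals Q rQ)"
  using finite_posets
  by (auto intro: finite_subset[of _ "Pow P"] finite_subset[of _ "Pow Q"] simp: poset_ideals_def)

lemma finite_idealsP: "finite idealsP" and finite_idealsQ: "finite idealsQ"
  using finite_ideals by auto

lemma finite_ideal:
  "I \<in> poset_ideals P rP \<Longrightarrow> finite I" "J \<in> poset_ideals Q rQ \<Longrightarrow> finite J"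
  using finite_posets finite_subset unfolding poset_ideals_def by blast+

lemma finite_vars: "finite vars"
  unfolding vars_eq using finite_ideals by simp

lemma xv_in_vars: "I \<in> poset_ideals P rP \<Longrightarrow> xv I \<in> vars"
  unfolding vars_eq xv_def by auto

lemma yv_in_vars: "J \<in> poset_ideals Q rQ \<Longrightarrow> yv J \<in> vars"
  unfolding vars_eq yv_def by auto

lemma xv_less:
  assumes "I \<in> poset_ideals P rP" "I' \<in> poset_ideals P rP" "I' \<subset> I"
  shows "(xv I', xv I) \<in> var_le" "xv I' \<noteq> xv I"
  using assms Xvar_le Zvar_le_Xvar unfolding xv_def by auto

lemma yv_less:
  assumes "J \<in> poset_ideals Q rQ" "J' \<in> poset_ideals Q rQ" "J' \<subset> J"
  shows "(yv J', yv J) \<in> var_le" "yv J' \<noteq> yv J"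
  using assms Yvar_le Zvar_le_Yvar unfolding yv_def by auto

lemma exponent_xv: "exponent (xv I) = rho d p I"
  by (simp add: xv_def rho_empty)

lemma exponent_yv: "exponent (yv J) = - rho d q J"
  by (simp add: yv_def rho_empty)

lemma x_var_mult: "(x_var I * x_var I' :: (('a, 'b) toric_var, 'k::field) mpoly) =
    Poly_Mapping.single (pair_monomial (xv I) (xv I')) 1"
  by (simp add: x_var_def Var_def xv_def mult_single)

lemma y_var_mult: "(y_var J * y_var J' :: (('a, 'b) toric_var, 'k::field) mpoly) =
    Poly_Mapping.single (pair_monomial (yv J) (yv J')) 1"
  by (simp add: y_var_def Var_def yv_def mult_single)

lemma x_var_y_var_mult: "(x_var I * y_var J :: (('a, 'b) toric_var, 'k::field) mpoly) =
    Poly_Mapping.single (pair_monomial (xv I) (yv J)) 1"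
  by (simp add: x_var_def y_var_def Var_def xv_def yv_def mult_single)

lemma image_exponent_pair:
  "image_exponent exponent (pair_monomial a b) = (exponent a + exponent b, 2)"
  unfolding image_exponent_add image_exponent_single by simp

text \<open>
  The variable of \<open>I \<inter> I'\<close> is smaller than those of \<open>I\<close> and \<open>I'\<close>, properly so only if \<open>I\<close> and \<open>I'\<close>
  are incomparable; for comparable ones the two monomials coincide.
\<close>

lemma admissible_xx:
  assumes I: "I \<in> poset_ideals P rP" "I' \<in> poset_ideals P rP" and "\<not> I \<subseteq> I'" "\<not> I' \<subseteq> I"
  shows "admissible_binomial vars var_le exponent
    (pair_monomial (xv I) (xv I')) (pair_monomial (xv (I \<inter> I')) (xv (I \<union> I')))"
proof -
  note J = poset_ideals_Int_Un[OF I]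
  have "I \<inter> I' \<subset> I" "I \<inter> I' \<subset> I'"
    using assms(3,4) by blast+
  then have "revlex var_le (pair_monomial (xv (I \<inter> I')) (xv (I \<union> I'))) (pair_monomial (xv I) (xv I'))"
    using I J by (intro revlex_pair_monomial[OF var_order] xv_less xv_in_vars)
  then show ?thesis
    unfolding admissible_binomial_def image_exponent_pair exponent_xv keys_pair_monomial
    using xv_in_vars I J rho_Int_Un[of d p I I'] by simp
qed

lemma admissible_yy:
  assumes J: "J \<in> poset_ideals Q rQ" "J' \<in> poset_ideals Q rQ" and "\<not> J \<subseteq> J'" "\<not> J' \<subseteq> J"
  shows "admissible_binomial vars var_le exponent
    (pair_monomial (yv J) (yv J')) (pair_monomial (yv (J \<inter> J')) (yv (J \<union> J')))"
proof -
  note K = poset_ideals_Int_Un[OF J]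
  have "J \<inter> J' \<subset> J" "J \<inter> J' \<subset> J'"
    using assms(3,4) by blast+
  then have "revlex var_le (pair_monomial (yv (J \<inter> J')) (yv (J \<union> J'))) (pair_monomial (yv J) (yv J'))"
    using J K by (intro revlex_pair_monomial[OF var_order] yv_less yv_in_vars)
  moreover have "- rho d q J + - rho d q J' = - rho d q (J \<inter> J') + - rho d q (J \<union> J')"
    using arg_cong[OF rho_Int_Un[of d q J J'], of uminus] by simp
  ultimately show ?thesis
    unfolding admissible_binomial_def image_exponent_pair exponent_yv keys_pair_monomial
    using yv_in_vars J K by simp
qed

lemma admissible_xy:
  assumes I: "I \<in> poset_ideals P rP" "maximal_in rP I (p i)"
    and J: "J \<in> poset_ideals Q rQ" "maximal_in rQ J (q i)" and i: "i \<in> {1..d}"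
  shows "admissible_binomial vars var_le exponent
    (pair_monomial (xv I) (yv J)) (pair_monomial (xv (I - {p i})) (yv (J - {q i})))"
proof -
  note I' = poset_ideals_remove_maximal[OF I] and J' = poset_ideals_remove_maximal[OF J]
  have mem: "p i \<in> I" "q i \<in> J"
    using I(2) J(2) unfolding maximal_in_def by auto
  then have "I - {p i} \<subset> I" "J - {q i} \<subset> J"
    by auto
  then have "revlex var_le (pair_monomial (xv (I - {p i})) (yv (J - {q i}))) (pair_monomial (xv I) (yv J))"
    using I(1) J(1) I' J'
    by (intro revlex_pair_monomial_both[OF var_order] xv_less yv_less xv_in_vars yv_in_vars)
  moreover have "rho d p I + - rho d q J = rho d p (I - {p i}) + - rho d q (J - {q i})"
  proof -
    have "inj_on p {1..d}" "inj_on q {1..d}"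
      using P Q unfolding labelled_poset_def bij_betw_def by auto
    then show ?thesis
      using rho_remove[of p d i I] rho_remove[of q d i J] i mem by simp
  qed
  ultimately show ?thesis
    unfolding admissible_binomial_def image_exponent_pair exponent_xv exponent_yv keys_pair_monomial
    using xv_in_vars yv_in_vars I(1) J(1) I' J' by simp
qed

abbreviation binomials :: "(('a, 'b) toric_var, 'k::field) mpoly set" where
  "binomials \<equiv> toric_binomials d P rP p Q rQ q"

lemma binomials_cases:
  assumes "g \<in> (binomials :: (('a, 'b) toric_var, 'k::field) mpoly set)"
  obtains (xx) I I' where "g = x_var I * x_var I' - x_var (I \<inter> I') * x_var (I \<union> I')"
      "I \<in> poset_ideals P rP" "I' \<in> poset_ideals P rP"
    | (yy) J J' where "g = y_var J * y_var J' - y_var (J \<inter> J') * y_var (J \<union> J')"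
      "J \<in> poset_ideals Q rQ" "J' \<in> poset_ideals Q rQ"
    | (xy) I J i where "g = x_var I * y_var J - x_var (I - {p i}) * y_var (J - {q i})"
      "I \<in> poset_ideals P rP" "J \<in> poset_ideals Q rQ" "i \<in> {1..d}"
      "maximal_in rP I (p i)" "maximal_in rQ J (q i)"
  using assms unfolding toric_binomials_def by blast

text \<open>
  The first two families contain zero for comparable ideals; excluding it leaves exactly the
  incomparable pairs.
\<close>

lemma binomials_admissible:
  assumes g: "g \<in> (binomials :: (('a, 'b) toric_var, 'k::field) mpoly set)"
  shows "\<exists>u v. g = Poly_Mapping.single u 1 - Poly_Mapping.single v 1 \<and>
    admissible_binomial vars var_le exponent u v"
proof -
  have "g \<noteq> 0"
    using g unfolding toric_binomials_def by blast
  from g show ?thesis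
  proof (cases rule: binomials_cases)
    case (xx I I')
    have "\<not> I \<subseteq> I'" "\<not> I' \<subseteq> I"
      using \<open>g \<noteq> 0\<close> xx(1) by (auto simp: Int_absorb1 Int_absorb2 Un_absorb1 Un_absorb2 mult.commute)
    then show ?thesis
      using admissible_xx[OF xx(2,3)] xx(1) unfolding x_var_mult by blast
  next
    case (yy J J')
    have "\<not> J \<subseteq> J'" "\<not> J' \<subseteq> J"
      using \<open>g \<noteq> 0\<close> yy(1) by (auto simp: Int_absorb1 Int_absorb2 Un_absorb1 Un_absorb2 mult.commute)
    then show ?thesis
      using admissible_yy[OF yy(2,3)] yy(1) unfolding y_var_mult by blast
  next
    case (xy I J i)
    then show ?thesis
      using admissible_xy[OF xy(2,5,3,6,4)] xy(1) unfolding x_var_y_var_mult by blast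
  qed
qed

lemma finite_binomials: "finite (binomials :: (('a, 'b) toric_var, 'k::field) mpoly set)"
proof -
  let ?X = "poset_ideals P rP" and ?Y = "poset_ideals Q rQ"
  let ?xx = "\<lambda>(I, I'). x_var I * x_var I' - x_var (I \<inter> I') * x_var (I \<union> I')"
  let ?yy = "\<lambda>(J, J'). y_var J * y_var J' - y_var (J \<inter> J') * y_var (J \<union> J')"
  let ?xy = "\<lambda>(I, J, i). x_var I * y_var J - x_var (I - {p i}) * y_var (J - {q i})"
  have sub: "(binomials :: (('a, 'b) toric_var, 'k) mpoly set) \<subseteq>
      ?xx ` (?X \<times> ?X) \<union> ?yy ` (?Y \<times> ?Y) \<union> ?xy ` (?X \<times> ?Y \<times> {1..d})"
  proof
    fix g :: "(('a, 'b) toric_var, 'k) mpoly"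
    assume "g \<in> binomials"
    then show "g \<in> ?xx ` (?X \<times> ?X) \<union> ?yy ` (?Y \<times> ?Y) \<union> ?xy ` (?X \<times> ?Y \<times> {1..d})"
    proof (cases rule: binomials_cases)
      case (xx I I')
      then show ?thesis
        by (intro UnI1 image_eqI[of _ _ "(I, I')"]) simp_all
    next
      case (yy J J')
      then show ?thesis
        by (intro UnI1[OF UnI2] image_eqI[of _ _ "(J, J')"]) simp_all
    next
      case (xy I J i)
      then show ?thesis
        by (intro UnI2 image_eqI[of _ _ "(I, J, i)"]) simp_all
    qed
  qed
  show ?thesis
    by (rule finite_subset[OF sub]) (use finite_ideals in simp)
qed

lemma not_standard_pair:
  assumes g: "Poly_Mapping.single (pair_monomial a b) 1 - Poly_Mapping.single v 1 \<in>
      (binomials :: (('a, 'b) toric_var, 'k::field) mpoly set)"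
    and adm: "admissible_binomial vars var_le exponent (pair_monomial a b) v"
    and ab: "a \<noteq> b" "Poly_Mapping.lookup m a \<noteq> 0" "Poly_Mapping.lookup m b \<noteq> 0"
  shows "\<not> standard_monomial var_le (binomials :: (('a, 'b) toric_var, 'k) mpoly set) m"
  using g initial_monomial_binomial[OF var_order adm] pair_monomial_divides[OF ab]
  unfolding standard_monomial_def by blast

lemma binomial_nonzero:
  assumes "admissible_binomial vars var_le exponent u v"
  shows "Poly_Mapping.single u 1 - Poly_Mapping.single v (1::'k::field) \<noteq> 0"
  using keys_binomial[OF admissible_binomial_neq[OF assms], where 'k = 'k] by (metis insert_not_empty keys_zero)

lemma standard_chain_supported:
  assumes std: "standard_monomial var_le (binomials :: (('a, 'b) toric_var, 'k::field) mpoly set) m"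
  shows "chain_supported idealsP (\<lambda>I. Poly_Mapping.lookup m (Xvar I))"
    and "chain_supported idealsQ (\<lambda>J. Poly_Mapping.lookup m (Yvar J))"
proof -
  show "chain_supported idealsP (\<lambda>I. Poly_Mapping.lookup m (Xvar I))"
    unfolding chain_supported_def
  proof (intro ballI impI, rule ccontr)
    fix I I' assume I: "I \<in> idealsP" "I' \<in> idealsP"
      and m: "Poly_Mapping.lookup m (Xvar I) \<noteq> 0" "Poly_Mapping.lookup m (Xvar I') \<noteq> 0"
      and "\<not> (I \<subseteq> I' \<or> I' \<subseteq> I)"
    then have adm: "admissible_binomial vars var_le exponent
        (pair_monomial (xv I) (xv I')) (pair_monomial (xv (I \<inter> I')) (xv (I \<union> I')))"
      by (intro admissible_xx) auto
    have "Poly_Mapping.single (pair_monomial (xv I) (xv I')) 1 -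
        Poly_Mapping.single (pair_monomial (xv (I \<inter> I')) (xv (I \<union> I'))) 1 \<in>
        (binomials :: (('a, 'b) toric_var, 'k) mpoly set)"
      using I binomial_nonzero[OF adm, where 'k = 'k] unfolding toric_binomials_def x_var_mult by blast
    then have "\<not> standard_monomial var_le (binomials :: (('a, 'b) toric_var, 'k) mpoly set) m"
      by (rule not_standard_pair[OF _ adm])
        (use I m \<open>\<not> (I \<subseteq> I' \<or> I' \<subseteq> I)\<close> in \<open>auto simp: xv_def\<close>)
    then show False
      using std by blast
  qed
  show "chain_supported idealsQ (\<lambda>J. Poly_Mapping.lookup m (Yvar J))"
    unfolding chain_supported_def
  proof (intro ballI impI, rule ccontr)
    fix J J' assume J: "J \<in> idealsQ" "J' \<in> idealsQ"
      and m: "Poly_Mapping.lookup m (Yvar J) \<noteq> 0" "Poly_Mapping.lookup m (Yvar J') \<noteq> 0"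
      and "\<not> (J \<subseteq> J' \<or> J' \<subseteq> J)"
    then have adm: "admissible_binomial vars var_le exponent
        (pair_monomial (yv J) (yv J')) (pair_monomial (yv (J \<inter> J')) (yv (J \<union> J')))"
      by (intro admissible_yy) auto
    have "Poly_Mapping.single (pair_monomial (yv J) (yv J')) 1 -
        Poly_Mapping.single (pair_monomial (yv (J \<inter> J')) (yv (J \<union> J'))) 1 \<in>
        (binomials :: (('a, 'b) toric_var, 'k) mpoly set)"
      using J binomial_nonzero[OF adm, where 'k = 'k] unfolding toric_binomials_def y_var_mult by blast
    then have "\<not> standard_monomial var_le (binomials :: (('a, 'b) toric_var, 'k) mpoly set) m"
      by (rule not_standard_pair[OF _ adm])
        (use J m \<open>\<not> (J \<subseteq> J' \<or> J' \<subseteq> J)\<close> in \<open>auto simp: yv_def\<close>)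
    then show False
      using std by blast
  qed
qed

lemma standard_no_common_maximal:
  assumes std: "standard_monomial var_le (binomials :: (('a, 'b) toric_var, 'k::field) mpoly set) m"
    and I: "I \<in> idealsP" "Poly_Mapping.lookup m (Xvar I) \<noteq> 0" "maximal_in rP I (p i)"
    and J: "J \<in> idealsQ" "Poly_Mapping.lookup m (Yvar J) \<noteq> 0" "maximal_in rQ J (q i)"
    and i: "i \<in> {1..d}"
  shows False
proof -
  have IJ: "I \<in> poset_ideals P rP" "J \<in> poset_ideals Q rQ"
    using I J by auto
  note adm = admissible_xy[OF IJ(1) I(3) IJ(2) J(3) i]
  have "Poly_Mapping.single (pair_monomial (xv I) (yv J)) 1 -
      Poly_Mapping.single (pair_monomial (xv (I - {p i})) (yv (J - {q i}))) 1 \<in>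
      (binomials :: (('a, 'b) toric_var, 'k) mpoly set)"
    using IJ I(3) J(3) i binomial_nonzero[OF adm, where 'k = 'k]
    unfolding toric_binomials_def x_var_y_var_mult by blast
  then have "\<not> standard_monomial var_le (binomials :: (('a, 'b) toric_var, 'k) mpoly set) m"
    by (rule not_standard_pair[OF _ adm]) (use I J in \<open>auto simp: xv_def yv_def\<close>)
  then show False
    using std by blast
qed

lemma label_later:
  assumes "labelled_poset d R r l" "linear_extension d r l \<sigma>" "a \<in> {1..d}"
    and y: "y \<in> R" "(l (\<sigma> a), y) \<in> r" "y \<noteq> l (\<sigma> a)"
  obtains b where "b \<in> {1..d}" "a < b" "y = l (\<sigma> b)"
proof -
  have "bij_betw l {1..d} R" "bij_betw \<sigma> {1..d} {1..d}"
    using assms(1,2) permutes_imp_bij unfolding labelled_poset_def linear_extension_def by blast+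
  then obtain b where "b \<in> {1..d}" "y = l (\<sigma> b)"
    using y(1) unfolding bij_betw_def by (metis (no_types, lifting) imageE)
  moreover from this have "a < b"
    using assms(2,3) y(2,3) unfolding linear_extension_def by auto
  ultimately show thesis
    using that by blast
qed

lemma label_in:
  assumes "a \<in> {1..d}"
  shows "\<sigma> a \<in> {1..d}" "p (\<sigma> a) \<in> P" "q (\<sigma> a) \<in> Q"
proof -
  show "\<sigma> a \<in> {1..d}"
    using assms \<sigma>P permutes_in_image unfolding linear_extension_def by metis
  then show "p (\<sigma> a) \<in> P" "q (\<sigma> a) \<in> Q"
    using P Q unfolding labelled_poset_def bij_betw_def by blast+
qed

lemma counts_difference:
  assumes "Poly_Mapping.keys m \<subseteq> vars" "Poly_Mapping.keys m' \<subseteq> vars"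
    and "image_exponent exponent m = image_exponent exponent m'" "i \<in> {1..d}"
  shows "int (countP m (p i)) - int (countQ m (q i)) = int (countP m' (p i)) - int (countQ m' (q i))"
  using var_exponent_lookup_sum[OF finite_idealsP finite_idealsQ assms(1)[unfolded vars_eq] assms(4), of p q]
    var_exponent_lookup_sum[OF finite_idealsP finite_idealsQ assms(2)[unfolded vars_eq] assms(4), of p q]
    assms(3) by simp

text \<open>
  If \<open>\<sigma> a\<close> were a label with greater count in \<open>m\<close> and equal counts behind it, then
  \<open>p (\<sigma> a)\<close> would be covered more often by \<open>m\<close> than every element above it, as those elements come
  later in \<open>\<sigma>\<close> and are covered by \<open>m'\<close> at most as often as \<open>p (\<sigma> a)\<close> is. The difference of the
  counts for \<open>P\<close> and \<open>Q\<close> is fixed, so the same holds for \<open>q (\<sigma> a)\<close>. Both elements are then maximal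
  in members of the two chains, which is what the third family of binomials forbids.
\<close>

lemma standard_count_not_greater:
  assumes std: "standard_monomial var_le (binomials :: (('a, 'b) toric_var, 'k::field) mpoly set) m"
    and V: "Poly_Mapping.keys m \<subseteq> vars" "Poly_Mapping.keys m' \<subseteq> vars"
    and eq: "image_exponent exponent m = image_exponent exponent m'"
    and a: "a \<in> {1..d}"
    and later: "\<And>b. b \<in> {1..d} \<Longrightarrow> a < b \<Longrightarrow> countP m (p (\<sigma> b)) = countP m' (p (\<sigma> b))"
  shows "\<not> countP m' (p (\<sigma> a)) < countP m (p (\<sigma> a))"
proof
  assume greater: "countP m' (p (\<sigma> a)) < countP m (p (\<sigma> a))"
  note diff = counts_difference[OF V eq label_in(1)]
  have "\<exists>I\<in>idealsP. Poly_Mapping.lookup m (Xvar I) \<noteq> 0 \<and> maximal_in rP I (p (\<sigma> a))"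
  proof (rule maximal_in_chain_member[where P = P])
    fix y assume y: "y \<in> P" "(p (\<sigma> a), y) \<in> rP" "y \<noteq> p (\<sigma> a)"
    obtain b where b: "b \<in> {1..d}" "a < b" "y = p (\<sigma> b)"
      by (rule label_later[OF P \<sigma>P a y])
    have "countP m' y \<le> countP m' (p (\<sigma> a))"
      using y(2) label_in[OF a] by (intro cover_count_antimono[OF finite_idealsP, where P = P]) auto
    then show "countP m y < countP m (p (\<sigma> a))"
      using greater later[OF b(1,2)] b(3) by simp
  qed (use greater finite_idealsP finite_ideal standard_chain_supported[OF std] in auto)
  moreover have "\<exists>J\<in>idealsQ. Poly_Mapping.lookup m (Yvar J) \<noteq> 0 \<and> maximal_in rQ J (q (\<sigma> a))"
  proof (rule maximal_in_chain_member[where P = Q])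
    have greaterQ: "countQ m' (q (\<sigma> a)) < countQ m (q (\<sigma> a))"
      using greater diff[OF a] by simp
    then show "0 < countQ m (q (\<sigma> a))"
      by simp
    fix y assume y: "y \<in> Q" "(q (\<sigma> a), y) \<in> rQ" "y \<noteq> q (\<sigma> a)"
    obtain b where b: "b \<in> {1..d}" "a < b" "y = q (\<sigma> b)"
      by (rule label_later[OF Q \<sigma>Q a y])
    have "countQ m' y \<le> countQ m' (q (\<sigma> a))"
      using y(2) label_in[OF a] by (intro cover_count_antimono[OF finite_idealsQ, where P = Q]) auto
    then show "countQ m y < countQ m (q (\<sigma> a))"
      using greaterQ later[OF b(1,2)] diff[OF b(1)] b(3) by simp
  qed (use finite_idealsQ finite_ideal standard_chain_supported[OF std] in auto)
  ultimately show False
    using standard_no_common_maximal[OF std] label_in(1)[OF a] by blast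
qed

lemma standard_counts_eq:
  assumes std: "standard_monomial var_le (binomials :: (('a, 'b) toric_var, 'k::field) mpoly set) m"
      "standard_monomial var_le (binomials :: (('a, 'b) toric_var, 'k) mpoly set) m'"
    and V: "Poly_Mapping.keys m \<subseteq> vars" "Poly_Mapping.keys m' \<subseteq> vars"
    and eq: "image_exponent exponent m = image_exponent exponent m'"
    and i: "i \<in> {1..d}"
  shows "countP m (p i) = countP m' (p i)" "countQ m (q i) = countQ m' (q i)"
proof -
  define S where "S = {a \<in> {1..d}. countP m (p (\<sigma> a)) \<noteq> countP m' (p (\<sigma> a))}"
  have "S = {}"
  proof (rule ccontr)
    assume "S \<noteq> {}"
    moreover have "finite S"
      unfolding S_def by simp
    ultimately have a: "Max S \<in> S" and max: "\<And>b. b \<in> S \<Longrightarrow> b \<le> Max S"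
      by auto
    have later: "countP m (p (\<sigma> b)) = countP m' (p (\<sigma> b))" if "b \<in> {1..d}" "Max S < b" for b
    proof -
      have "b \<notin> S"
        using max[of b] that(2) by auto
      then show ?thesis
        using that(1) unfolding S_def by simp
    qed
    have "Max S \<in> {1..d}"
      using a unfolding S_def by blast
    then have "\<not> countP m' (p (\<sigma> (Max S))) < countP m (p (\<sigma> (Max S)))"
        "\<not> countP m (p (\<sigma> (Max S))) < countP m' (p (\<sigma> (Max S)))"
      using standard_count_not_greater[OF std(1) V eq _ later]
        standard_count_not_greater[OF std(2) V(2,1) eq[symmetric] _ later[symmetric]] by blast+
    then show False
      using a unfolding S_def by simp
  qed
  have "\<sigma> permutes {1..d}"
    using \<sigma>P unfolding linear_extension_def by blast
  then have "i \<in> \<sigma> ` {1..d}"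
    using i permutes_image by blast
  then show "countP m (p i) = countP m' (p i)"
    using \<open>S = {}\<close> unfolding S_def by auto
  then show "countQ m (q i) = countQ m' (q i)"
    using counts_difference[OF V eq i] by simp
qed

lemma standard_monomial_unique:
  assumes V: "Poly_Mapping.keys m \<subseteq> vars" "Poly_Mapping.keys m' \<subseteq> vars"
    and eq: "image_exponent exponent m = image_exponent exponent m'"
    and std: "standard_monomial var_le (binomials :: (('a, 'b) toric_var, 'k::field) mpoly set) m"
      "standard_monomial var_le (binomials :: (('a, 'b) toric_var, 'k) mpoly set) m'"
  shows "m = m'"
proof -
  have labels: "\<exists>i\<in>{1..d}. x = p i" if "x \<in> P" for x
    using that P unfolding labelled_poset_def bij_betw_def by blast
  have labels': "\<exists>i\<in>{1..d}. y = q i" if "y \<in> Q" for y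
    using that Q unfolding labelled_poset_def bij_betw_def by blast
  have X: "Poly_Mapping.lookup m (Xvar I) = Poly_Mapping.lookup m' (Xvar I)" if "I \<in> idealsP" for I
  proof (rule chain_supported_unique[OF finite_idealsP _ _
        standard_chain_supported(1)[OF std(1)] standard_chain_supported(1)[OF std(2)] _ that])
    fix I x assume "I \<in> idealsP" "x \<in> I"
    then have "x \<in> P"
      unfolding poset_ideals_def by blast
    then show "countP m x = countP m' x"
      using labels standard_counts_eq(1)[OF std V eq] by blast
  qed (use finite_ideal in auto)
  have Y: "Poly_Mapping.lookup m (Yvar J) = Poly_Mapping.lookup m' (Yvar J)" if "J \<in> idealsQ" for J
  proof (rule chain_supported_unique[OF finite_idealsQ _ _
        standard_chain_supported(2)[OF std(1)] standard_chain_supported(2)[OF std(2)] _ that])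
    fix J y assume "J \<in> idealsQ" "y \<in> J"
    then have "y \<in> Q"
      unfolding poset_ideals_def by blast
    then show "countQ m y = countQ m' y"
      using labels' standard_counts_eq(2)[OF std V eq] by blast
  qed (use finite_ideal in auto)
  have "mdeg m = mdeg m'"
    using eq unfolding image_exponent_def by simp
  then have Z: "Poly_Mapping.lookup m Zvar = Poly_Mapping.lookup m' Zvar"
    unfolding mdeg_toric_var[OF finite_idealsP finite_idealsQ V(1)[unfolded vars_eq]]
      mdeg_toric_var[OF finite_idealsP finite_idealsQ V(2)[unfolded vars_eq]]
    using X Y by simp
  show "m = m'"
  proof (rule poly_mapping_eqI)
    fix v
    show "Poly_Mapping.lookup m v = Poly_Mapping.lookup m' v"
    proof (cases "v \<in> vars")
      case True
      then show ?thesis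
        using X Y Z unfolding vars_eq by blast
    next
      case False
      then show ?thesis
        using V by (metis in_keys_iff subsetD)
    qed
  qed
qed

lemma toric_ideal_eq:
  "(toric_ideal d P rP p Q rQ q :: (('a, 'b) toric_var, 'k::field) mpoly set) =
    {f \<in> carrier (mpoly_ring vars). subst_hom (pi_var d p q) f = 0}"
  unfolding toric_ideal_def a_kernel_def' by (simp add: toric_ring_def laurent_ring_def)

lemma groebner_basis_binomials:
  "groebner_basis vars (revlex var_le)
    (toric_ideal d P rP p Q rQ q :: (('a, 'b) toric_var, 'k::field) mpoly set) binomials"
  unfolding toric_ideal_eq
  by (rule groebner_basis_criterion[OF finite_vars var_order finite_binomials pi_var_eq_t_s
        binomials_admissible standard_monomial_unique])

end

theorem theorem2p1:
  fixes d :: nat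
    and P :: "'a set" and rP :: "'a rel" and p :: "nat \<Rightarrow> 'a"
    and Q :: "'b set" and rQ :: "'b rel" and q :: "nat \<Rightarrow> 'b"
    and var_le :: "('a, 'b) toric_var rel"
  assumes "labelled_poset d P rP p"
    and "labelled_poset d Q rQ q"
    and "linear_order_on (toric_vars P rP Q rQ) var_le"
    and "\<And>I. I \<in> poset_ideals P rP \<Longrightarrow> I \<noteq> {} \<Longrightarrow> (Zvar, Xvar I) \<in> var_le"
    and "\<And>J. J \<in> poset_ideals Q rQ \<Longrightarrow> J \<noteq> {} \<Longrightarrow> (Zvar, Yvar J) \<in> var_le"
    and "\<And>I I'. I \<in> poset_ideals P rP \<Longrightarrow> I' \<in> poset_ideals P rP \<Longrightarrow>
           I' \<noteq> {} \<Longrightarrow> I' \<subset> I \<Longrightarrow> (Xvar I', Xvar I) \<in> var_le"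
    and "\<And>J J'. J \<in> poset_ideals Q rQ \<Longrightarrow> J' \<in> poset_ideals Q rQ \<Longrightarrow>
           J' \<noteq> {} \<Longrightarrow> J' \<subset> J \<Longrightarrow> (Yvar J', Yvar J) \<in> var_le"
    and "have_common_linear_extension d rP p rQ q"
  shows "groebner_basis (toric_vars P rP Q rQ) (revlex var_le)
           (toric_ideal d P rP p Q rQ q :: (('a, 'b) toric_var, 'k::field) mpoly set)
           (toric_binomials d P rP p Q rQ q)"
proof -
  obtain \<sigma> where "linear_extension d rP p \<sigma>" "linear_extension d rQ q \<sigma>"
    using assms(8) unfolding have_common_linear_extension_def by blast
  then interpret common_linear_extension d P rP p Q rQ q var_le \<sigma>
    using assms(1-7) by unfold_locales
  show ?thesis
    by (rule groebner_basis_binomials)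
qed

end
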